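(* Assume that $m$ changes sign in $]T_1,T_2[$ and let $N\in\{1,2,\ldots,+\infty\}$ be the number of changes of sign of $m$. Then the total number of nonempty sets $C_k^{>+-}$ and $C_k^{<+-}$ with $k\ge 2$ is equal to $2N-1$.
   Context: Let $T_1<T_2$ be reals and let $p,q,m\in C[T_1,T_2]$ be real-valued with $p>0$, $q\ge 0$ on $[T_1,T_2]$, $m\not\equiv 0$. Put $Lu:=-(p(t)u')'+q(t)u$ and, for any function $u$, $u^{\pm}:=\max\{\pm u,0\}$ (likewise $m^{\pm}$). For $(a,b)\in\mathbb{R}^2$ consider the one weight problem $$(P)\qquad Lu=m(t)(au^{+}-bu^{-})\ \text{in } ]T_1,T_2[,\qquad u(T_1)=u(T_2)=0,$$ solutions being functions $u\in C^1[T_1,T_2]$ with $pu'\in C^1[T_1,T_2]$. For $k\ge 1$, $C_k^{>}$ (resp. $C_k^{<}$) is the set of $(a,b)\in\mathbb{R}^2$ such that $(P)$ has a solution $u$ with exactly $k-1$ zeros in $]T_1,T_2[$ and $u'(T_1)>0$ (resp. $u'(T_1)<0$). Put $C_k^{>+-}:=C_k^{>}\cap(\mathbb{R}^{+}\times\mathbb{R}^{-})$, $C_k^{<+-}:=C_k^{<}\cap(\mathbb{R}^{+}\times\mathbb{R}^{-})$, with $\mathbb{R}^{+}=]0,+\infty[$, $\mathbb{R}^{-}=]-\infty,0[$. When counting nonempty sets, $C_k^{>+-}$ and $C_k^{<+-}$ are counted separately even if they coincide; $2\cdot(+\infty)-1=+\infty$. "$m$ changes sign in $]T_1,T_2[$"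 means $m^{+}\not\equiv0$ and $m^{-}\not\equiv 0$ there. The number of changes of sign is defined as follows. Write $m\gneqq 0$ (resp. $m\lneqq 0$) on an interval if $m\ge0$ (resp. $m\le 0$) and $m\not\equiv0$ on it. Simple point: $s\in]T_1,T_2[$ is a simple point of change of sign of $m$ if there exist $T_1<s'\le s$ and $\epsilon_0>0$ such that either (i) for all $0<\epsilon<\epsilon_0$, $m\lneqq0$ on $]s'-\epsilon,s'[$ and $m\gneqq0$ on $]s,s+\epsilon[$, and $m\equiv0$ on $[s',s]$; or (ii) for all $0<\epsilon<\epsilon_0$, $m\gneqq0$ on $]s'-\epsilon,s'[$ and $m\lneqq0$ on $]s,s+\epsilon[$, and $m\equiv0$ on $[s',s]$. Multiple point: $s\in[T_1,T_2]$ is a multiple point of change of sign of $m$ if either (i) $s>T_1$ and $m^{+}$ and $m^{-}$ are both $\not\equiv0$ on $]s-\epsilon,s[\,\cap[T_1,T_2]$ for any $\epsilon>0$, or (ii) $s<T_2$ and $m^{+}$ and $m^{-}$ are both $\not\equiv0$ on $]s,s+\epsilon[\,\cap[T_1,T_2]$ for any $\epsilon>0$. If $m$ admits at least one multiple point of change of sign, the number of changes of sign of $m$ is $+\infty$. Otherwise (when $m$ changes sign) $m$ has a nonzero finite number $N$ of simple points of change of sign, and the number of changes of sign of $m$ is $N$. *)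

theory Defs
  imports "HOL-Analysis.Analysis" "HOL-Library.Extended_Nat"
begin

definition ppart :: "(real \<Rightarrow> real) \<Rightarrow> real \<Rightarrow> real" where
  "ppart f t = max (f t) 0"

definition npart :: "(real \<Rightarrow> real) \<Rightarrow> real \<Rightarrow> real" where
  "npart f t = max (- f t) 0"

definition ecard :: "'a set \<Rightarrow> enat" where
  "ecard A = (if finite A then enat (card A) else \<infinity>)"


text \<open>
  Functions on \<open>[T1, T2]\<close> are represented by total functions whose values outside
  \<open>[T1, T2]\<close> are irrelevant; derivatives are taken within \<open>[T1, T2]\<close>, hence one-sided at
  the end points and two-sided in the interior.
\<close>

definition C1_on :: "real set \<Rightarrow> (real \<Rightarrow> real) \<Rightarrow> bool" where
  "C1_on S f \<longleftrightarrow>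
     (\<exists>f'. (\<forall>t\<in>S. (f has_real_derivative f' t) (at t within S)) \<and> continuous_on S f')"

definition deriv_on :: "real set \<Rightarrow> (real \<Rightarrow> real) \<Rightarrow> real \<Rightarrow> real" where
  "deriv_on S f t = vector_derivative f (at t within S)"

definition Lop :: "real \<Rightarrow> real \<Rightarrow> (real \<Rightarrow> real) \<Rightarrow> (real \<Rightarrow> real) \<Rightarrow> (real \<Rightarrow> real) \<Rightarrow> real \<Rightarrow> real" where
  "Lop T1 T2 p q u t =
     - deriv_on {T1..T2} (\<lambda>s. p s * deriv_on {T1..T2} u s) t + q t * u t"

definition solution_P ::
  "real \<Rightarrow> real \<Rightarrow> (real \<Rightarrow> real) \<Rightarrow> (real \<Rightarrow> real) \<Rightarrow> (real \<Rightarrow> real) \<Rightarrow> real \<Rightarrow> real \<Rightarrow> (real \<Rightarrow> real) \<Rightarrow> bool"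
where
  "solution_P T1 T2 p q m a b u \<longleftrightarrow>
     C1_on {T1..T2} u \<and>
     C1_on {T1..T2} (\<lambda>t. p t * deriv_on {T1..T2} u t) \<and>
     (\<forall>t\<in>{T1<..<T2}. Lop T1 T2 p q u t = m t * (a * ppart u t - b * npart u t)) \<and>
     u T1 = 0 \<and> u T2 = 0"

definition exactly_zeros :: "real \<Rightarrow> real \<Rightarrow> (real \<Rightarrow> real) \<Rightarrow> nat \<Rightarrow> bool" where
  "exactly_zeros T1 T2 u n \<longleftrightarrow>
     finite {t\<in>{T1<..<T2}. u t = 0} \<and> card {t\<in>{T1<..<T2}. u t = 0} = n"

definition C_gt ::
  "real \<Rightarrow> real \<Rightarrow> (real \<Rightarrow> real) \<Rightarrow> (real \<Rightarrow> real) \<Rightarrow> (real \<Rightarrow> real) \<Rightarrow> nat \<Rightarrow> (real \<times> real) set"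
where
  "C_gt T1 T2 p q m k =
     {(a, b). \<exists>u. solution_P T1 T2 p q m a b u \<and> exactly_zeros T1 T2 u (k - 1) \<and>
                  deriv_on {T1..T2} u T1 > 0}"

definition C_lt ::
  "real \<Rightarrow> real \<Rightarrow> (real \<Rightarrow> real) \<Rightarrow> (real \<Rightarrow> real) \<Rightarrow> (real \<Rightarrow> real) \<Rightarrow> nat \<Rightarrow> (real \<times> real) set"
where
  "C_lt T1 T2 p q m k =
     {(a, b). \<exists>u. solution_P T1 T2 p q m a b u \<and> exactly_zeros T1 T2 u (k - 1) \<and>
                  deriv_on {T1..T2} u T1 < 0}"

definition C_gt_pm ::
  "real \<Rightarrow> real \<Rightarrow> (real \<Rightarrow> real) \<Rightarrow> (real \<Rightarrow> real) \<Rightarrow> (real \<Rightarrow> real) \<Rightarrow> nat \<Rightarrow> (real \<times> real) set"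
where
  "C_gt_pm T1 T2 p q m k = C_gt T1 T2 p q m k \<inter> ({0<..} \<times> {..<0})"

definition C_lt_pm ::
  "real \<Rightarrow> real \<Rightarrow> (real \<Rightarrow> real) \<Rightarrow> (real \<Rightarrow> real) \<Rightarrow> (real \<Rightarrow> real) \<Rightarrow> nat \<Rightarrow> (real \<times> real) set"
where
  "C_lt_pm T1 T2 p q m k = C_lt T1 T2 p q m k \<inter> ({0<..} \<times> {..<0})"


definition not_identically_zero_on :: "real set \<Rightarrow> (real \<Rightarrow> real) \<Rightarrow> bool" where
  "not_identically_zero_on I f \<longleftrightarrow> (\<exists>t\<in>I. f t \<noteq> 0)"

definition gneqq0_on :: "real set \<Rightarrow> (real \<Rightarrow> real) \<Rightarrow> bool" where
  "gneqq0_on I f \<longleftrightarrow> (\<forall>t\<in>I. f t \<ge> 0) \<and> not_identically_zero_on I f"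

definition lneqq0_on :: "real set \<Rightarrow> (real \<Rightarrow> real) \<Rightarrow> bool" where
  "lneqq0_on I f \<longleftrightarrow> (\<forall>t\<in>I. f t \<le> 0) \<and> not_identically_zero_on I f"

definition changes_sign :: "real \<Rightarrow> real \<Rightarrow> (real \<Rightarrow> real) \<Rightarrow> bool" where
  "changes_sign T1 T2 m \<longleftrightarrow>
     not_identically_zero_on {T1<..<T2} (ppart m) \<and>
     not_identically_zero_on {T1<..<T2} (npart m)"

text \<open>
  The bounds on \<open>e0\<close> only make the one-sided neighbourhoods lie in the domain \<open>[T1, T2]\<close>
  of \<open>m\<close>.
\<close>

definition simple_change_point :: "real \<Rightarrow> real \<Rightarrow> (real \<Rightarrow> real) \<Rightarrow> real \<Rightarrow> bool" where
  "simple_change_point T1 T2 m s \<longleftrightarrow>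
     T1 < s \<and> s < T2 \<and>
     (\<exists>s' e0. T1 < s' \<and> s' \<le> s \<and> 0 < e0 \<and> T1 \<le> s' - e0 \<and> s + e0 \<le> T2 \<and>
        (((\<forall>e. 0 < e \<and> e < e0 \<longrightarrow>
             lneqq0_on {s' - e<..<s'} m \<and> gneqq0_on {s<..<s + e} m) \<and>
          (\<forall>t\<in>{s'..s}. m t = 0)) \<or>
         ((\<forall>e. 0 < e \<and> e < e0 \<longrightarrow>
             gneqq0_on {s' - e<..<s'} m \<and> lneqq0_on {s<..<s + e} m) \<and>
          (\<forall>t\<in>{s'..s}. m t = 0))))"

definition multiple_change_point :: "real \<Rightarrow> real \<Rightarrow> (real \<Rightarrow> real) \<Rightarrow> real \<Rightarrow> bool" where
  "multiple_change_point T1 T2 m s \<longleftrightarrow>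
     T1 \<le> s \<and> s \<le> T2 \<and>
     ((T1 < s \<and> (\<forall>e>0.
         not_identically_zero_on ({s - e<..<s} \<inter> {T1..T2}) (ppart m) \<and>
         not_identically_zero_on ({s - e<..<s} \<inter> {T1..T2}) (npart m))) \<or>
      (s < T2 \<and> (\<forall>e>0.
         not_identically_zero_on ({s<..<s + e} \<inter> {T1..T2}) (ppart m) \<and>
         not_identically_zero_on ({s<..<s + e} \<inter> {T1..T2}) (npart m))))"

definition num_sign_changes :: "real \<Rightarrow> real \<Rightarrow> (real \<Rightarrow> real) \<Rightarrow> enat" where
  "num_sign_changes T1 T2 m =
     (if \<exists>s. multiple_change_point T1 T2 m s then \<infinity>
      else ecard {s. simple_change_point T1 T2 m s})"

text \<open>
  The two families are indexed by \<open>k\<close> and counted separately: it is the indices of nonempty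
  sets that are counted, so equal sets are not identified.
\<close>

definition num_nonempty_sets ::
  "real \<Rightarrow> real \<Rightarrow> (real \<Rightarrow> real) \<Rightarrow> (real \<Rightarrow> real) \<Rightarrow> (real \<Rightarrow> real) \<Rightarrow> enat" where
  "num_nonempty_sets T1 T2 p q m =
     ecard {k. k \<ge> 2 \<and> C_gt_pm T1 T2 p q m k \<noteq> {}} +
     ecard {k. k \<ge> 2 \<and> C_lt_pm T1 T2 p q m k \<noteq> {}}"

end

theory Submission
  imports Defs
begin

text \<open>
  Put \<open>\<beta> = - b > 0\<close>.  The right-hand side is then \<open>m (a u\<^sup>+ + \<beta> u\<^sup>-)\<close>, so a positive
  bump of \<open>u\<close> is a positive solution for the weight \<open>a m\<close>, while a negative bump is, after a
  change of sign, a positive solution for the weight \<open>- \<beta> m\<close>.  A positive solution with Dirichlet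
  data needs a point where its weight is positive, by the maximum principle.  Hence a solution
  with \<open>k - 1\<close> interior zeros and positive initial slope yields \<open>k\<close> points, one inside each
  bump, at which \<open>m\<close> is alternately positive and negative (\<open>solution_imp_alternating\<close>); this
  uses that the zeros are simple, so that the bumps do alternate.

  Conversely, such a chain of \<open>k\<close> points suffices, and a pair on the line
  \<open>a = - b = \<kappa>\<close> can be found.  In polar coordinates \<open>u = r sin \<theta>\<close>,
  \<open>p u' = r cos \<theta>\<close> the equation \<open>L u = \<kappa> m \<bar>u\<bar>\<close> decouples into a scalar equation for
  \<open>\<theta>\<close> with Lipschitz right-hand side, and \<open>\<theta>\<close> crosses every multiple of \<open>\<pi>\<close>
  strictly upwards.  So \<open>u\<close> vanishes at \<open>T2\<close> with exactly \<open>k - 1\<close> interior zeros as soon as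
  \<open>\<theta>(T2) = k \<pi>\<close>.  At \<open>\<kappa> = 0\<close> the final angle is below \<open>\<pi>\<close>
  (\<open>angle_zero_parameter\<close>).  When \<open>\<kappa>\<close> is large, each sign interval of \<open>m\<close> in the chain
  forces the angle through one more half turn (\<open>angle_traverse\<close>), so that it reaches
  \<open>k \<pi>\<close> (\<open>angle_large_parameter\<close>).  The final angle depends continuously on
  \<open>\<kappa>\<close>, and the intermediate value theorem gives the parameter.

  It remains to count the lengths of alternating chains of points.  A multiple point of change
  of sign gives chains of every length.  Otherwise the simple points are finite in number, a
  chain with \<open>n\<close> changes of sign encloses \<open>n\<close> of them, and conversely \<open>n\<close> of them generate
  such a chain.  A longest chain therefore has \<open>N + 1\<close> points, and chains starting with the
  opposite sign have at most \<open>N\<close> points, since otherwise one could be prolonged.  Counting lengths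
  \<open>k \<ge> 2\<close> for both starting signs gives \<open>N + (N - 1)\<close>.
\<close>

section \<open>Alternating chains and points of change of sign\<close>

text \<open>
  Chains are encoded by recursion on their first point instead of as lists, because the arguments
  below split off the leftmost point, zero or bump and continue to the right of it.
\<close>

primrec alternating :: "(real \<Rightarrow> real) \<Rightarrow> real \<Rightarrow> nat \<Rightarrow> real \<Rightarrow> real \<Rightarrow> bool" where
  "alternating m T 0 \<sigma> \<alpha> \<longleftrightarrow> True"
| "alternating m T (Suc n) \<sigma> \<alpha> \<longleftrightarrow>
     (\<exists>x. \<alpha> < x \<and> x < T \<and> \<sigma> * m x > 0 \<and> alternating m T n (-\<sigma>) x)"

lemma alternating_left: "alternating m T n \<sigma> \<alpha> \<Longrightarrow> \<beta> \<le> \<alpha> \<Longrightarrow> alternating m T n \<sigma> \<beta>"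
  by (cases n) force+

lemma alternating_shorter: "alternating m T n \<sigma> \<alpha> \<Longrightarrow> k \<le> n \<Longrightarrow> alternating m T k \<sigma> \<alpha>"
proof (induction n arbitrary: k \<sigma> \<alpha>)
  case (Suc n) then show ?case by (cases k) auto
qed simp

lemma alternating_tail: "alternating m T (Suc n) \<sigma> \<alpha> \<Longrightarrow> alternating m T n (-\<sigma>) \<alpha>"
  using alternating_left[of m T n "-\<sigma>" _ \<alpha>] by force

lemma alternating_uminus: "alternating (\<lambda>t. - m t) T n \<sigma> \<alpha> \<longleftrightarrow> alternating m T n (-\<sigma>) \<alpha>"
  by (induction n arbitrary: \<sigma> \<alpha>) auto

text \<open>
  Compare the first points of two chains of opposite type: the smaller one can be put in front of
  the other chain.
\<close>

lemma alternating_opposite_extend: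
  assumes "alternating m T (Suc n) \<sigma> \<alpha>" "alternating m T (Suc n) (-\<sigma>) \<alpha>"
  shows "alternating m T (Suc (Suc n)) \<sigma> \<alpha> \<or> alternating m T (Suc (Suc n)) (-\<sigma>) \<alpha>"
proof -
  obtain x where x: "\<alpha> < x" "x < T" "\<sigma> * m x > 0" "alternating m T n (-\<sigma>) x"
    using assms(1) by auto
  obtain y where y: "\<alpha> < y" "y < T" "-\<sigma> * m y > 0" "alternating m T n \<sigma> y"
    using assms(2) by auto
  consider "x < y" | "y < x" | "x = y" by linarith
  then show ?thesis
  proof cases
    case 1
    have "alternating m T (Suc n) (-\<sigma>) x" using y 1 by auto
    then show ?thesis using x by auto
  next
    case 2
    have "alternating m T (Suc n) \<sigma> y" using x 2 by auto
    then have "alternating m T (Suc (Suc n)) (-\<sigma>) \<alpha>" using y by auto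
    then show ?thesis ..
  next
    case 3 then show ?thesis using x y by auto
  qed
qed

text \<open>
  Carrying the sign on the left as a parameter merges the two alternatives in the definition.
\<close>

lemma simple_change_point_iff:
  "simple_change_point T1 T2 m s \<longleftrightarrow> T1 < s \<and> s < T2 \<and>
     (\<exists>\<sigma>\<in>{1,-1}. \<exists>s' e0. T1 < s' \<and> s' \<le> s \<and> 0 < e0 \<and> T1 \<le> s' - e0 \<and> s + e0 \<le> T2 \<and>
        (\<forall>e. 0 < e \<and> e < e0 \<longrightarrow> gneqq0_on {s' - e<..<s'} (\<lambda>t. \<sigma> * m t) \<and>
            gneqq0_on {s<..<s + e} (\<lambda>t. - \<sigma> * m t)) \<and>
        (\<forall>t\<in>{s'..s}. m t = 0))"
proof -
  have neg: "lneqq0_on I m = gneqq0_on I (\<lambda>t. - m t)" for I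
    by (auto simp: lneqq0_on_def gneqq0_on_def not_identically_zero_on_def)
  show ?thesis
    unfolding simple_change_point_def neg by auto
qed

lemma multiple_change_point_iff:
  "multiple_change_point T1 T2 m s \<longleftrightarrow> T1 \<le> s \<and> s \<le> T2 \<and>
     ((T1 < s \<and> (\<forall>e>0. \<forall>\<sigma>\<in>{1,-1}. \<exists>t. s - e < t \<and> t < s \<and> T1 \<le> t \<and> t \<le> T2 \<and> \<sigma> * m t > 0)) \<or>
      (s < T2 \<and> (\<forall>e>0. \<forall>\<sigma>\<in>{1,-1}. \<exists>t. s < t \<and> t < s + e \<and> T1 \<le> t \<and> t \<le> T2 \<and> \<sigma> * m t > 0)))"
proof -
  have "not_identically_zero_on I (ppart m) \<and> not_identically_zero_on I (npart m) \<longleftrightarrow>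
      (\<forall>\<sigma>\<in>{1,-1}. \<exists>t\<in>I. \<sigma> * m t > 0)" for I
    unfolding not_identically_zero_on_def ppart_def npart_def
    by (auto simp: max_def not_le)
  then show ?thesis
    unfolding multiple_change_point_def
    by (simp add: Bex_def conj_assoc del: ball_simps)
qed

text \<open>
  The sign to the left of \<open>s\<close> is seen left of the plateau \<open>[s', s]\<close> on which \<open>m\<close> vanishes.  The
  plateau does not reach back to an earlier simple point \<open>\<alpha>\<close>, because \<open>m\<close> takes nonzero values
  immediately to the right of \<open>\<alpha>\<close>.
\<close>

lemma simple_change_point_crossing:
  assumes s: "simple_change_point T1 T2 m s" and "\<alpha> < s"
    and \<alpha>: "\<alpha> = T1 \<or> simple_change_point T1 T2 m \<alpha>"
  obtains \<sigma> x where "\<sigma> \<in> {1,-1}" "\<alpha> < x" "x < s" "\<sigma> * m x > 0"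
    "\<And>\<beta>. s < \<beta> \<Longrightarrow> \<exists>y. s < y \<and> y < \<beta> \<and> y < T2 \<and> - \<sigma> * m y > 0"
proof -
  have right: "\<exists>y. z < y \<and> y < \<beta> \<and> y < T2 \<and> - \<sigma> * m y > 0"
    if "\<forall>e. 0 < e \<and> e < e0 \<longrightarrow> gneqq0_on {z<..<z + e} (\<lambda>t. - \<sigma> * m t)" "0 < e0" "z + e0 \<le> T2" "z < \<beta>"
    for z e0 \<sigma> \<beta>
  proof -
    have "gneqq0_on {z<..<z + min (e0/2) (\<beta> - z)} (\<lambda>t. - \<sigma> * m t)"
      using that by auto
    then obtain y where "z < y" "y < z + min (e0/2) (\<beta> - z)" "- \<sigma> * m y > 0"
      unfolding gneqq0_on_def not_identically_zero_on_def by force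
    then show ?thesis using that by (intro exI[of _ y]) auto
  qed
  obtain \<sigma> s' e0 where \<sigma>: "\<sigma> \<in> {1,-1}" and s': "T1 < s'" "s' \<le> s" "0 < e0" "s + e0 \<le> T2"
    and *: "\<forall>e. 0 < e \<and> e < e0 \<longrightarrow> gneqq0_on {s' - e<..<s'} (\<lambda>t. \<sigma> * m t) \<and>
            gneqq0_on {s<..<s + e} (\<lambda>t. - \<sigma> * m t)" and z: "\<forall>t\<in>{s'..s}. m t = 0"
    using s unfolding simple_change_point_iff by blast
  have "\<alpha> < s'"
  proof (rule ccontr)
    assume "\<not> \<alpha> < s'"
    then have "simple_change_point T1 T2 m \<alpha>" using \<alpha> s' by auto
    then obtain \<tau> e1 where "0 < e1" "\<alpha> + e1 \<le> T2" "\<forall>e. 0 < e \<and> e < e1 \<longrightarrow> gneqq0_on {\<alpha><..<\<alpha> + e} (\<lambda>t. - \<tau> * m t)"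
      unfolding simple_change_point_iff by blast
    from right[OF this(3,1,2) \<open>\<alpha> < s\<close>] z \<open>\<not> \<alpha> < s'\<close> show False by force
  qed
  then have "gneqq0_on {s' - min (e0/2) (s' - \<alpha>)<..<s'} (\<lambda>t. \<sigma> * m t)"
    using * s' by auto
  then obtain x where "s' - min (e0/2) (s' - \<alpha>) < x" "x < s'" "\<sigma> * m x > 0"
    unfolding gneqq0_on_def not_identically_zero_on_def by force
  moreover have "\<exists>y. s < y \<and> y < \<beta> \<and> y < T2 \<and> - \<sigma> * m y > 0" if "s < \<beta>" for \<beta>
    using right[of e0 s \<sigma> \<beta>] * s' that by blast
  ultimately show ?thesis using that[of \<sigma> x] \<sigma> s' by auto
qed

text \<open>
  Normalise to \<open>f x > 0 > f y\<close>.  Let \<open>s\<close> be the infimum of the points of \<open>[x, y]\<close> where \<open>f\<close> is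
  negative and \<open>s'\<close> the supremum of the points of \<open>[x, s]\<close> where it is positive.  Then \<open>f\<close> is
  nonnegative left of \<open>s\<close> and vanishes on \<open>[s', s]\<close>; immediately to the right of \<open>s\<close> it takes
  negative values, and no positive ones since \<open>s\<close> is not a multiple point.
\<close>

lemma simple_change_point_between:
  assumes cont: "continuous_on {T1..T2} m" and nomult: "\<And>s. \<not> multiple_change_point T1 T2 m s"
    and x: "T1 < x" "x < y" "y < T2" and \<sigma>: "\<sigma> \<in> {1,-1}" "\<sigma> * m x > 0" "\<sigma> * m y < 0"
  shows "\<exists>s. x < s \<and> s < y \<and> simple_change_point T1 T2 m s"
proof -
  define f where "f t = \<sigma> * m t" for t
  have fc: "continuous_on {T1..T2} f"
    unfolding f_def by (intro continuous_intros cont)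
  have near: "\<exists>d>0. \<forall>t. \<bar>t - c\<bar> < d \<longrightarrow> T1 < t \<and> t < T2 \<and> f c * f t > 0" 
    if c: "T1 < c" "c < T2" "f c \<noteq> 0" for c
  proof -
    have "isCont f c" using continuous_on_interior[OF fc, of c] c by simp
    then obtain d where d: "d > 0" "\<And>t. \<bar>t - c\<bar> < d \<Longrightarrow> \<bar>f t - f c\<bar> < \<bar>f c\<bar>"
      unfolding continuous_at_eps_delta dist_real_def using c by (metis zero_less_abs_iff)
    have "f c * f t > 0" if "\<bar>t - c\<bar> < d" for t
      using d(2)[OF that] by (auto simp: zero_less_mult_iff)
    then show ?thesis using d(1) c
      by (intro exI[of _ "min d (min (c - T1) (T2 - c))"]) auto
  qed
  define N where "N = {t. x \<le> t \<and> t \<le> y \<and> f t < 0}"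
  define s where "s = Inf N"
  have yN: "y \<in> N" using x \<sigma> by (auto simp: N_def f_def)
  have bN: "bdd_below N" unfolding N_def bdd_below_def by auto
  have s_le: "s \<le> t" if "t \<in> N" for t unfolding s_def by (rule cInf_lower[OF that bN])
  have s_near: "\<exists>t\<in>N. t < s + e" if "e > 0" for e
    using cInf_lessD[of N "s + e"] yN that unfolding s_def[symmetric] by auto
  have "x \<le> s" unfolding s_def using yN by (intro cInf_greatest) (auto simp: N_def)
  have "s \<le> y" using s_le yN by auto
  have fs: "f s = 0"
  proof (rule ccontr)
    assume "f s \<noteq> 0"
    then obtain d where d: "d > 0" "\<And>t. \<bar>t - s\<bar> < d \<Longrightarrow> f s * f t > 0"
      using near[of s] x \<open>x \<le> s\<close> \<open>s \<le> y\<close> by auto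
    obtain t where "t \<in> N" "t < s + d" using s_near d by blast
    then have "f s * f t > 0" "f t < 0" using d(2)[of t] s_le[of t] by (auto simp: N_def)
    then have "f s < 0" by (simp add: zero_less_mult_iff)
    then have "s \<noteq> x" using \<sigma> by (auto simp: f_def)
    define t' where "t' = max x (s - d/2)"
    have "\<bar>t' - s\<bar> < d" "t' < s" "x \<le> t'" using \<open>x \<le> s\<close> \<open>s \<noteq> x\<close> d by (auto simp: t'_def)
    then have "f t' < 0" using d(2)[of t'] \<open>f s < 0\<close> by (auto simp: zero_less_mult_iff)
    then show False using s_le[of t'] \<open>x \<le> t'\<close> \<open>t' < s\<close> \<open>s \<le> y\<close> by (auto simp: N_def)
  qed
  have sx: "x < s" "s < y" using fs \<sigma> \<open>x \<le> s\<close> \<open>s \<le> y\<close> by (auto simp: f_def order_le_less)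
  have s_right: "\<exists>t. s < t \<and> t < s + e \<and> f t < 0" if "e > 0" for e
    using s_near[OF that] s_le fs by (force simp: N_def order_le_less)
  have left_pos: "f t \<ge> 0" if "x \<le> t" "t < s" for t
    using s_le[of t] that sx by (force simp: N_def)
  define Q where "Q = {t. x \<le> t \<and> t \<le> s \<and> f t > 0}"
  define s' where "s' = Sup Q"
  have xQ: "x \<in> Q" using sx \<sigma> by (auto simp: Q_def f_def)
  have bQ: "bdd_above Q" unfolding Q_def bdd_above_def by auto
  have s'_ge: "t \<le> s'" if "t \<in> Q" for t unfolding s'_def by (rule cSup_upper[OF that bQ])
  have s'_near: "\<exists>t\<in>Q. s' - e < t" if "e > 0" for e
    using less_cSupD[of Q "s' - e"] xQ that unfolding s'_def[symmetric] by auto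
  have "x \<le> s'" using s'_ge xQ by auto
  have "s' \<le> s" unfolding s'_def using xQ by (intro cSup_least) (auto simp: Q_def)
  have fs': "f s' = 0"
  proof (rule ccontr)
    assume nz: "f s' \<noteq> 0"
    then obtain d where d: "d > 0" "\<And>t. \<bar>t - s'\<bar> < d \<Longrightarrow> f s' * f t > 0"
      using near[of s'] x \<open>x \<le> s'\<close> \<open>s' \<le> s\<close> sx by auto
    have "s' < s" using nz fs \<open>s' \<le> s\<close> by (auto simp: order_le_less)
    then have "f s' > 0" using left_pos[of s'] nz \<open>x \<le> s'\<close> by auto
    define t' where "t' = min s (s' + d/2)"
    have "\<bar>t' - s'\<bar> < d" "t' > s'" "t' \<le> s" using \<open>s' < s\<close> d by (auto simp: t'_def)
    then have "f t' > 0" using d(2)[of t'] \<open>f s' > 0\<close> by (auto simp: zero_less_mult_iff)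
    then show False using s'_ge[of t'] \<open>x \<le> s'\<close> \<open>t' > s'\<close> \<open>t' \<le> s\<close> by (auto simp: Q_def)
  qed
  have s'_left: "\<exists>t. s' - e < t \<and> t < s' \<and> f t > 0" if "e > 0" for e
    using s'_near[OF that] s'_ge fs' by (force simp: Q_def order_le_less)
  have s'x: "x < s'" using fs' \<sigma> \<open>x \<le> s'\<close> by (auto simp: f_def order_le_less)
  have zero: "f t = 0" if "s' \<le> t" "t \<le> s" for t
  proof -
    have "t \<in> Q \<Longrightarrow> t = s'" using s'_ge[of t] that by auto
    then show ?thesis using left_pos[of t] that fs fs' s'x by (force simp: Q_def order_le_less)
  qed
  obtain e1 where e1: "e1 > 0" "\<And>t. s < t \<Longrightarrow> t < s + e1 \<Longrightarrow> t \<le> T2 \<Longrightarrow> f t \<le> 0"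
  proof -
    have "s < T2" "T1 \<le> s" "s \<le> T2" using sx x by auto
    then obtain e \<tau> where e: "e > 0" "\<tau> \<in> {1,-1}"
       "\<And>t. s < t \<and> t < s + e \<and> T1 \<le> t \<and> t \<le> T2 \<Longrightarrow> \<not> \<tau> * m t > 0"
      using nomult[of s] unfolding multiple_change_point_iff by blast
    obtain t0 where t0: "s < t0" "t0 < s + min e (T2 - s)" "f t0 < 0"
      using s_right[of "min e (T2 - s)"] e \<open>s < T2\<close> by auto
    then have "t0 < s + e" "t0 \<le> T2" by (auto simp: min_def split: if_splits)
    then have "\<not> \<tau> * m t0 > 0" using e(3)[of t0] t0(1) \<open>T1 \<le> s\<close> by auto
    then have "\<tau> = \<sigma>" using e(2) \<sigma>(1) t0(3) by (auto simp: f_def)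
    then have "f t \<le> 0" if "s < t" "t < s + e" "t \<le> T2" for t
      using e(3)[of t] that \<open>T1 \<le> s\<close> by (auto simp: f_def not_less)
    then show ?thesis using that e by blast
  qed
  define e0 where "e0 = min e1 (min (s' - x) (T2 - s))"
  have "gneqq0_on {s' - e<..<s'} (\<lambda>t. \<sigma> * m t)" "gneqq0_on {s<..<s + e} (\<lambda>t. - \<sigma> * m t)"
    if e: "0 < e" "e < e0" for e
  proof -
    show "gneqq0_on {s' - e<..<s'} (\<lambda>t. \<sigma> * m t)"
      unfolding gneqq0_on_def not_identically_zero_on_def f_def[symmetric]
      using left_pos s'_left[of e] e \<open>s' \<le> s\<close> by (force simp: e0_def)
    show "gneqq0_on {s<..<s + e} (\<lambda>t. - \<sigma> * m t)"
      unfolding gneqq0_on_def not_identically_zero_on_def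
      using e1 s_right[of e] e by (force simp: e0_def f_def)
  qed
  moreover have "0 < e0" "T1 \<le> s' - e0" "s + e0 \<le> T2" "T1 < s'" "T1 < s" "s < T2"
    using e1 s'x sx x by (auto simp: e0_def)
  moreover have "\<forall>t\<in>{s'..s}. m t = 0" using zero \<sigma> by (auto simp: f_def)
  ultimately have "simple_change_point T1 T2 m s"
    unfolding simple_change_point_iff using \<open>s' \<le> s\<close> \<sigma>(1) by blast
  then show ?thesis using sx by blast
qed

text \<open>
  The simple points found between consecutive points of the chain are distinct.
\<close>

lemma alternating_imp_simple_change_points:
  assumes cont: "continuous_on {T1..T2} m" and nomult: "\<And>s. \<not> multiple_change_point T1 T2 m s"
    and "T1 < x" "\<sigma> \<in> {1,-1}" "\<sigma> * m x > 0" "alternating m T2 n (-\<sigma>) x"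
  shows "\<exists>F. finite F \<and> card F = n \<and> F \<subseteq> {s. x < s \<and> simple_change_point T1 T2 m s}"
  using assms(3-)
proof (induction n arbitrary: x \<sigma>)
  case 0 show ?case by (intro exI[of _ "{}"]) auto
next
  case (Suc n)
  then obtain y where y: "x < y" "y < T2" "-\<sigma> * m y > 0" "alternating m T2 n \<sigma> y" by auto
  then obtain F where F: "finite F" "card F = n" "F \<subseteq> {s. y < s \<and> simple_change_point T1 T2 m s}"
    using Suc.IH[of y "-\<sigma>"] Suc.prems by auto
  obtain s where s: "x < s" "s < y" "simple_change_point T1 T2 m s"
    using simple_change_point_between[OF cont nomult, of x y \<sigma>] Suc.prems y by auto
  have "s \<notin> F" using F s by auto
  then show ?case using F s y by (intro exI[of _ "insert s F"]) auto
qed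

text \<open>
  Induction on the number of simple points, removing the leftmost one \<open>s\<close>.  If the chain that
  exists to the right of \<open>s\<close> starts with the sign which \<open>m\<close> has left of \<open>s\<close>, a point just to the
  right of \<open>s\<close> is inserted in between.
\<close>

lemma simple_change_points_imp_alternating:
  assumes "finite F" "F \<subseteq> {s. \<alpha> < s \<and> simple_change_point T1 T2 m s}" "F \<noteq> {}"
    "\<alpha> = T1 \<or> simple_change_point T1 T2 m \<alpha>"
  shows "\<exists>\<sigma>\<in>{1,-1}. alternating m T2 (Suc (card F)) \<sigma> \<alpha>"
  using assms
proof (induction "card F" arbitrary: F \<alpha>)
  case 0 then show ?case by auto
next
  case (Suc n)
  define s where "s = Min F"
  have sF: "s \<in> F" "\<And>t. t \<in> F \<Longrightarrow> s \<le> t" unfolding s_def using Suc.prems by auto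
  then obtain \<sigma> x where \<sigma>: "\<sigma> \<in> {1,-1}" and x: "\<alpha> < x" "x < s" "\<sigma> * m x > 0"
    and r: "\<And>\<beta>. s < \<beta> \<Longrightarrow> \<exists>y. s < y \<and> y < \<beta> \<and> y < T2 \<and> - \<sigma> * m y > 0"
    using simple_change_point_crossing[of T1 T2 m s \<alpha>] Suc.prems by blast
  have card: "card (F - {s}) = n" "finite (F - {s})" using Suc sF by auto
  have "alternating m T2 (Suc n) (-\<sigma>) s"
  proof (cases "F - {s} = {}")
    case True
    then have "n = 0" using card by auto
    then show ?thesis using r[of "s + 1"] by auto
  next
    case False
    have "F - {s} \<subseteq> {z. s < z \<and> simple_change_point T1 T2 m z}"
      using sF Suc.prems by (force simp: order_le_less)
    moreover have "simple_change_point T1 T2 m s" using sF Suc.prems by auto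
    ultimately obtain \<tau> where \<tau>: "\<tau> \<in> {1,-1}" "alternating m T2 (Suc n) \<tau> s"
      using Suc.hyps(1)[of "F - {s}" s] card False by metis
    show ?thesis
    proof (cases "\<tau> = -\<sigma>")
      case True then show ?thesis using \<tau> by simp
    next
      case False
      then have "\<tau> = \<sigma>" using \<tau> \<sigma> by auto
      then obtain z where z: "s < z" "z < T2" "\<sigma> * m z > 0" "alternating m T2 n (-\<sigma>) z"
        using \<tau> by auto
      obtain y where "s < y" "y < z" "y < T2" "-\<sigma> * m y > 0" using r[OF z(1)] by auto
      then have "alternating m T2 (Suc (Suc n)) (-\<sigma>) s" using z by auto
      then show ?thesis by (rule alternating_shorter) simp
    qed
  qed
  moreover have "s < T2" using sF Suc.prems by (auto simp: simple_change_point_def)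
  ultimately have "alternating m T2 (Suc (Suc n)) \<sigma> \<alpha>"
    using x alternating_left[of m T2 "Suc n" "-\<sigma>" s x] by (auto simp del: alternating.simps(2) simp: alternating.simps(2)[of m T2 "Suc n" \<sigma> \<alpha>] intro!: exI[of _ x])
  then show ?case using Suc.hyps(2) \<sigma> by auto
qed

text \<open>
  Chains are built towards the multiple point when both signs accumulate from its left.  When they
  accumulate from its right, chains are built away from it and each new point is put in front.
\<close>

lemma multiple_change_point_imp_alternating:
  assumes "multiple_change_point T1 T2 m s" "\<sigma> \<in> {1,-1}"
  shows "alternating m T2 n \<sigma> T1"
  using assms(1) unfolding multiple_change_point_iff
proof (elim conjE disjE)
  assume s: "T1 < s" "s \<le> T2" and
    e: "\<forall>e>0. \<forall>\<sigma>\<in>{1,-1}. \<exists>t. s - e < t \<and> t < s \<and> T1 \<le> t \<and> t \<le> T2 \<and> \<sigma> * m t > 0"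
  have "alternating m T2 n \<sigma> \<alpha>" if "T1 \<le> \<alpha>" "\<alpha> < s" for \<alpha>
    using that assms(2)
  proof (induction n arbitrary: \<sigma> \<alpha>)
    case (Suc n)
    then obtain t where "s - (s - \<alpha>) < t" "t < s" "\<sigma> * m t > 0"
      using e[rule_format, of "s - \<alpha>" \<sigma>] by auto
    then show ?case using Suc.IH[of t "-\<sigma>"] Suc.prems s by (auto intro!: exI[of _ t])
  qed simp
  then show ?thesis using s by simp
next
  assume s: "T1 \<le> s" "s < T2" and
    e: "\<forall>e>0. \<forall>\<sigma>\<in>{1,-1}. \<exists>t. s < t \<and> t < s + e \<and> T1 \<le> t \<and> t \<le> T2 \<and> \<sigma> * m t > 0"
  have "\<exists>\<alpha>. s < \<alpha> \<and> \<alpha> < T2 \<and> alternating m T2 n \<sigma> \<alpha>"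
    using assms(2)
  proof (induction n arbitrary: \<sigma>)
    case 0 then show ?case using dense[OF s(2)] by auto
  next
    case (Suc n)
    have "-\<sigma> \<in> {1,-1}" using Suc.prems by auto
    from Suc.IH[OF this] obtain \<alpha> where \<alpha>: "s < \<alpha>" "\<alpha> < T2" "alternating m T2 n (-\<sigma>) \<alpha>"
      by blast
    obtain t where t: "s < t" "t < s + (\<alpha> - s)" "\<sigma> * m t > 0"
      using e[rule_format, of "\<alpha> - s" \<sigma>] Suc.prems \<alpha> by auto
    obtain \<beta> where "s < \<beta>" "\<beta> < t" using dense[OF t(1)] by auto
    moreover have "alternating m T2 n (-\<sigma>) t" using alternating_left[OF \<alpha>(3)] t by simp
    ultimately show ?case using \<alpha> t by (intro exI[of _ \<beta>]) auto
  qed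
  then show ?thesis using s alternating_left[of m T2 n \<sigma> _ T1] by auto
qed

text \<open>
  Infinitely many simple points accumulate somewhere, on one side.  Near the limit \<open>c\<close> two of them
  lie on that side, and the second one exhibits both signs between the first one and \<open>c\<close>, or
  between the first one and the end of the given neighbourhood.  So \<open>c\<close> would be a multiple point.
\<close>

lemma finite_simple_change_points:
  assumes nomult: "\<And>s. \<not> multiple_change_point T1 T2 m s"
  shows "finite {s. simple_change_point T1 T2 m s}" (is "finite ?S")
proof (rule ccontr)
  assume inf: "infinite ?S"
  have sub: "?S \<subseteq> {T1..T2}" by (auto simp: simple_change_point_def)
  obtain c where c: "c \<in> {T1..T2}" "c islimpt ?S"
    using Heine_Borel_imp_Bolzano_Weierstrass[OF compact_Icc inf sub] by auto
  have "?S = (?S \<inter> {..c}) \<union> (?S \<inter> {c..})" by auto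
  then have "c islimpt (?S \<inter> {..c}) \<or> c islimpt (?S \<inter> {c..})" using c(2) islimpt_Un by metis
  have both: "\<forall>\<tau>\<in>{1,-1}. \<exists>t. s1 < t \<and> t < \<beta> \<and> T1 \<le> t \<and> t \<le> T2 \<and> \<tau> * m t > 0"
    if s12: "s1 \<in> ?S" "s2 \<in> ?S" "s1 < s2" "s2 < \<beta>" for s1 s2 \<beta>
  proof -
    obtain \<sigma> x where \<sigma>: "\<sigma> \<in> {1,-1}" and x: "s1 < x" "x < s2" "\<sigma> * m x > 0"
    and r: "\<And>\<beta>. s2 < \<beta> \<Longrightarrow> \<exists>y. s2 < y \<and> y < \<beta> \<and> y < T2 \<and> - \<sigma> * m y > 0"
      using simple_change_point_crossing[of T1 T2 m s2 s1] s12 by blast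
    obtain y where y: "s2 < y" "y < \<beta>" "y < T2" "-\<sigma> * m y > 0" using r[OF s12(4)] by auto
    have "T1 < s1" "s2 < T2" using s12 by (auto simp: simple_change_point_def)
    show ?thesis
    proof
      fix \<tau> :: real assume "\<tau> \<in> {1,-1}"
      then consider "\<tau> = \<sigma>" | "\<tau> = -\<sigma>" using \<sigma> by auto
      then show "\<exists>t. s1 < t \<and> t < \<beta> \<and> T1 \<le> t \<and> t \<le> T2 \<and> \<tau> * m t > 0"
      proof cases
        case 1 then show ?thesis using x s12 \<open>T1 < s1\<close> \<open>s2 < T2\<close> by (intro exI[of _ x]) auto
      next
        case 2 then show ?thesis using y s12 \<open>T1 < s1\<close> \<open>s2 < T2\<close> by (intro exI[of _ y]) auto
      qed
    qed
  qed
  have two: "\<exists>s1 s2. s1 \<in> A \<and> s2 \<in> A \<and> s1 < s2 \<and> \<bar>s1 - c\<bar> < e \<and> \<bar>s2 - c\<bar> < e \<and> s1 \<noteq> c \<and> s2 \<noteq> c"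
    if "c islimpt A" "e > 0" for A e
  proof -
    have near: "\<exists>x\<in>A. x \<noteq> c \<and> \<bar>x - c\<bar> < d" if "d > 0" for d
      using \<open>c islimpt A\<close> that unfolding islimpt_approachable dist_real_def by blast
    obtain s1 where s1: "s1 \<in> A" "s1 \<noteq> c" "\<bar>s1 - c\<bar> < e"
      using near[OF \<open>e > 0\<close>] by blast
    obtain s2 where s2: "s2 \<in> A" "s2 \<noteq> c" "\<bar>s2 - c\<bar> < \<bar>s1 - c\<bar>"
      using near[of "\<bar>s1 - c\<bar>"] s1 by auto
    show ?thesis
    proof (cases "s1 < s2")
      case True then show ?thesis using s1 s2 by (intro exI[of _ s1] exI[of _ s2]) auto
    next
      case False then show ?thesis using s1 s2 by (intro exI[of _ s2] exI[of _ s1]) auto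
    qed
  qed
  from \<open>c islimpt (?S \<inter> {..c}) \<or> c islimpt (?S \<inter> {c..})\<close> have "multiple_change_point T1 T2 m c"
  proof
    assume L: "c islimpt (?S \<inter> {..c})"
    have "\<forall>\<tau>\<in>{1,-1}. \<exists>t. c - e < t \<and> t < c \<and> T1 \<le> t \<and> t \<le> T2 \<and> \<tau> * m t > 0"
      if "e > 0" for e
    proof -
      obtain s1 s2 where "s1 \<in> ?S" "s2 \<in> ?S" "s1 < s2" "s2 < c" "c - e < s1"
        using two[OF L \<open>e > 0\<close>] by force
      from both[OF this(1-4)] this(5) show ?thesis by (meson less_trans)
    qed
    moreover have "T1 < c" using two[OF L zero_less_one] by (force simp: simple_change_point_def)
    ultimately show ?thesis using c(1) unfolding multiple_change_point_iff by auto
  next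
    assume R: "c islimpt (?S \<inter> {c..})"
    have "\<forall>\<tau>\<in>{1,-1}. \<exists>t. c < t \<and> t < c + e \<and> T1 \<le> t \<and> t \<le> T2 \<and> \<tau> * m t > 0"
      if "e > 0" for e
    proof -
      obtain s1 s2 where "s1 \<in> ?S" "s2 \<in> ?S" "s1 < s2" "s2 < c + e" "c < s1"
        using two[OF R \<open>e > 0\<close>] by force
      from both[OF this(1-4)] this(5) show ?thesis by (meson less_trans)
    qed
    moreover have "c < T2" using two[OF R zero_less_one] by (force simp: simple_change_point_def)
    ultimately show ?thesis using c(1) unfolding multiple_change_point_iff by auto
  qed
  then show False using nomult by blast
qed

text \<open>
  With \<open>n\<close> simple points and no multiple one, the lengths are \<open>2, \<dots>, n + 1\<close> for the sign
  with which a longest chain starts and \<open>2, \<dots>, n\<close> for the other sign; chains of the latter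
  kind are found by dropping the first point.
\<close>

lemma count_alternating:
  assumes cont: "continuous_on {T1..T2} m" and ch: "changes_sign T1 T2 m"
    and N: "N = num_sign_changes T1 T2 m"
  shows "1 \<le> N" and "ecard {k. k \<ge> 2 \<and> alternating m T2 k 1 T1} +
     ecard {k. k \<ge> 2 \<and> alternating m T2 k (-1) T1} = 2 * N - 1"
proof -
  have "1 \<le> N \<and> ecard {k. k \<ge> 2 \<and> alternating m T2 k 1 T1} +
     ecard {k. k \<ge> 2 \<and> alternating m T2 k (-1) T1} = 2 * N - 1"
  proof (cases "\<exists>s. multiple_change_point T1 T2 m s")
    case True
    then have "alternating m T2 k \<sigma> T1" if "\<sigma> \<in> {1,-1}" for k \<sigma>
      using multiple_change_point_imp_alternating that by blast
    then have "{k. k \<ge> 2 \<and> alternating m T2 k 1 T1} = {2..}" by auto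
    moreover have "N = \<infinity>" using True N by (simp add: num_sign_changes_def)
    ultimately show ?thesis by (simp add: ecard_def infinite_Ici imult_infinity_right) 
  next
    case False
    then have nomult: "\<And>s. \<not> multiple_change_point T1 T2 m s" by blast
    define S where "S = {s. simple_change_point T1 T2 m s}"
    define n where "n = card S"
    have fin: "finite S" unfolding S_def by (rule finite_simple_change_points[OF nomult])
    have Nn: "N = enat n" using False N fin by (simp add: num_sign_changes_def ecard_def S_def n_def)
    have le: "k \<le> n" if "alternating m T2 (Suc k) \<sigma> T1" "\<sigma> \<in> {1,-1}" for k \<sigma>
    proof -
      obtain x where "T1 < x" "\<sigma> * m x > 0" "alternating m T2 k (-\<sigma>) x"
        using \<open>alternating m T2 (Suc k) \<sigma> T1\<close> by auto
      then obtain F where "finite F" "card F = k" "F \<subseteq> S"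
        using alternating_imp_simple_change_points[OF cont nomult, of x \<sigma> k] \<open>\<sigma> \<in> {1,-1}\<close>
        unfolding S_def by blast
      then show ?thesis using card_mono[OF fin, of F] by (simp add: n_def)
    qed
    obtain x y where xy: "T1 < x" "x < T2" "m x > 0" "T1 < y" "y < T2" "m y < 0"
      using ch unfolding changes_sign_def not_identically_zero_on_def ppart_def npart_def
      by (auto simp: max_def split: if_splits)
    have "\<exists>\<sigma>\<in>{1,-1}. alternating m T2 (Suc (Suc 0)) \<sigma> T1"
    proof (cases "x < y")
      case True then show ?thesis using xy by auto
    next
      case False
      then have "y < x" using xy by (cases x y rule: linorder_cases) auto
      then have "alternating m T2 (Suc (Suc 0)) (-1) T1" using xy by auto
      then show ?thesis by blast
    qed
    then have n1: "1 \<le> n" using le by (metis One_nat_def)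
    then have "S \<noteq> {}" by (auto simp: n_def)
    moreover have "S \<subseteq> {s. T1 < s \<and> simple_change_point T1 T2 m s}"
      by (auto simp: S_def simple_change_point_def)
    ultimately obtain \<sigma> where \<sigma>: "\<sigma> \<in> {1,-1}" "alternating m T2 (Suc n) \<sigma> T1"
      using simple_change_points_imp_alternating[OF fin, of T1 T1 T2 m] unfolding n_def by blast
    have A: "{k. k \<ge> 2 \<and> alternating m T2 k \<sigma> T1} = {2..Suc n}"
    proof -
      have "k \<le> Suc n" if "k \<ge> 2" "alternating m T2 k \<sigma> T1" for k
        using le[of "k - 1" \<sigma>] that \<sigma> by auto
      then show ?thesis using alternating_shorter[OF \<sigma>(2)] by auto
    qed
    have B: "{k. k \<ge> 2 \<and> alternating m T2 k (-\<sigma>) T1} = {2..n}"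
    proof -
      \<comment> \<open>Two longest chains of opposite type would combine into a longer one.\<close>
      have *: "\<not> alternating m T2 (Suc n) (-\<sigma>) T1"
        using alternating_opposite_extend[OF \<sigma>(2)] le[of "Suc n" \<sigma>] le[of "Suc n" "-\<sigma>"] \<sigma>(1) by auto
      have "k \<le> n" if "alternating m T2 k (-\<sigma>) T1" for k
        using * alternating_shorter[OF that, of "Suc n"] by (meson not_less_eq_eq)
      then show ?thesis using alternating_shorter[OF alternating_tail[OF \<sigma>(2)]] by auto
    qed
    have "ecard {2..Suc n} + ecard {2..n} = 2 * N - 1"
      using n1 by (simp add: ecard_def Nn one_enat_def numeral_eq_enat)
    moreover have "ecard {k. k \<ge> 2 \<and> alternating m T2 k 1 T1} +
     ecard {k. k \<ge> 2 \<and> alternating m T2 k (-1) T1} =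
       ecard {k. k \<ge> 2 \<and> alternating m T2 k \<sigma> T1} +
     ecard {k. k \<ge> 2 \<and> alternating m T2 k (-\<sigma>) T1}" using \<sigma>(1) by (auto simp: add.commute)
    ultimately show ?thesis using n1 unfolding A B by (simp add: Nn one_enat_def)
  qed
  then show "1 \<le> N" and "ecard {k. k \<ge> 2 \<and> alternating m T2 k 1 T1} +
     ecard {k. k \<ge> 2 \<and> alternating m T2 k (-1) T1} = 2 * N - 1" by auto
qed

section \<open>Scalar differential equations\<close>

lemma abs_sin_diff_le: "\<bar>sin x - sin y\<bar> \<le> \<bar>x - y\<bar>" for x y :: real
proof -
  have "\<bar>sin x - sin y\<bar> = 2 * (\<bar>sin ((x - y) / 2)\<bar> * \<bar>cos ((x + y) / 2)\<bar>)"
    by (simp add: sin_diff_sin abs_mult)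
  also have "\<dots> \<le> 2 * (\<bar>(x - y) / 2\<bar> * 1)"
    by (intro mult_left_mono mult_mono abs_sin_x_le_abs_x) auto
  finally show ?thesis by simp
qed

text \<open>
  The Banach fixed point theorem, applied to \<open>w(t) = exp (- K t) \<theta>(t)\<close> rather than to
  \<open>\<theta>\<close>.  The exponential weight makes the integral operator a contraction on the whole interval at
  once.  Functions on \<open>[T1, T2]\<close> become bounded continuous functions on the line by freezing them
  outside the interval.
\<close>

lemma scalar_ivp_solvable:
  fixes f :: "real \<Rightarrow> real \<Rightarrow> real"
  assumes cont: "continuous_on ({T1..T2} \<times> UNIV) (\<lambda>(t, x). f t x)"
    and lip: "\<And>t x y. t \<in> {T1..T2} \<Longrightarrow> \<bar>f t x - f t y\<bar> \<le> L * \<bar>x - y\<bar>"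
    and "T1 \<le> T2"
  shows "\<exists>\<theta>. \<theta> T1 = x0 \<and>
    (\<forall>t\<in>{T1..T2}. (\<theta> has_real_derivative f t (\<theta> t)) (at t within {T1..T2}))"
proof -
  define M where "M = max L 1"
  define K where "K = 2 * M"
  have M: "M > 0" "L \<le> M" "K > 0" by (auto simp: M_def K_def)
  define cl where "cl t = max T1 (min T2 t)" for t
  have cl: "cl t \<in> {T1..T2}" for t using \<open>T1 \<le> T2\<close> by (auto simp: cl_def)
  have cl_id: "cl t = t" if "t \<in> {T1..T2}" for t using that by (auto simp: cl_def)
  define g where "g w s = f s (exp (K * s) * w s)" for w s
  define G where "G w t = exp (- K * t) * (x0 + integral {T1..t} (g w))" for w t
  have g_cont: "continuous_on {T1..T2} (g w)" if "continuous_on UNIV w" for w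
  proof -
    have "continuous_on {T1..T2} (\<lambda>s. (s, exp (K * s) * w s))"
      by (intro continuous_intros continuous_on_subset[OF that]) auto
    from continuous_on_compose2[OF cont this] show ?thesis by (auto simp: g_def)
  qed
  have G_cont: "continuous_on {T1..T2} (G w)" if "continuous_on UNIV w" for w
    unfolding G_def
    by (intro continuous_intros indefinite_integral_continuous_1 integrable_continuous_interval g_cont that)
  have G_bc: "(\<lambda>t. G w (cl t)) \<in> bcontfun" if "continuous_on UNIV w" for w
  proof -
    have "continuous_on UNIV cl" unfolding cl_def by (intro continuous_intros)
    then have "continuous_on UNIV (\<lambda>t. G w (cl t))"
      using continuous_on_compose2[OF G_cont[OF that]] cl by blast
    moreover have "bounded (range (\<lambda>t. G w (cl t)))"
      using compact_imp_bounded[OF compact_continuous_image[OF G_cont[OF that] compact_Icc]]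
      by (rule bounded_subset) (use cl in auto)
    ultimately show ?thesis by (simp add: bcontfun_def)
  qed
  define \<Phi> where "\<Phi> w = Bcontfun (\<lambda>t. G (apply_bcontfun w) (cl t))" for w
  have \<Phi>: "apply_bcontfun (\<Phi> w) t = G (apply_bcontfun w) (cl t)" for w t
    unfolding \<Phi>_def by (subst Bcontfun_inverse[OF G_bc]) auto
  have "dist (\<Phi> v) (\<Phi> w) \<le> (1/2) * dist v w" for v w
  proof (rule dist_bound)
    fix t0
    define D where "D = dist v w"
    define t where "t = cl t0"
    have t: "T1 \<le> t" "t \<le> T2" using cl[of t0] by (auto simp: t_def)
    have gi: "g (apply_bcontfun u) integrable_on {T1..t}" for u
      by (intro integrable_continuous_interval continuous_on_subset[OF g_cont]) (use t in auto)
    have E: "((\<lambda>s. M * D * exp (K * s)) has_integral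
         (D / 2 * exp (K * t) - D / 2 * exp (K * T1))) {T1..t}"
    proof (rule fundamental_theorem_of_calculus[OF t(1)])
      fix s
      have "((\<lambda>s. D / 2 * exp (K * s)) has_real_derivative M * D * exp (K * s)) (at s within {T1..t})"
        by (auto intro!: derivative_eq_intros simp: K_def)
      then show "((\<lambda>s. D / 2 * exp (K * s)) has_vector_derivative M * D * exp (K * s)) (at s within {T1..t})"
        by (simp add: has_real_derivative_iff_has_vector_derivative)
    qed
    have "norm (integral {T1..t} (\<lambda>s. g v s - g w s)) \<le> integral {T1..t} (\<lambda>s. M * D * exp (K * s))"
    proof (intro integral_norm_bound_integral integrable_diff gi)
      show "(\<lambda>s. M * D * exp (K * s)) integrable_on {T1..t}" using E by blast
      fix s assume "s \<in> {T1..t}"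
      then have "\<bar>g v s - g w s\<bar> \<le> L * \<bar>exp (K * s) * v s - exp (K * s) * w s\<bar>"
        unfolding g_def using t by (intro lip) auto
      also have "\<dots> \<le> M * \<bar>exp (K * s) * v s - exp (K * s) * w s\<bar>"
        using M by (intro mult_right_mono) auto
      also have "\<dots> = M * (exp (K * s) * \<bar>v s - w s\<bar>)"
        by (simp add: abs_mult flip: right_diff_distrib)
      also have "\<dots> \<le> M * (exp (K * s) * D)"
        using dist_bounded[of v s w] M by (intro mult_left_mono) (auto simp: D_def dist_real_def)
      finally show "norm (g v s - g w s) \<le> M * D * exp (K * s)" by (simp add: mult_ac)
    qed
    also have "\<dots> = D / 2 * exp (K * t) - D / 2 * exp (K * T1)" using E by (rule integral_unique)
    also have "\<dots> \<le> D / 2 * exp (K * t)" by (simp add: D_def)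
    finally have I: "\<bar>integral {T1..t} (g v) - integral {T1..t} (g w)\<bar> \<le> D / 2 * exp (K * t)"
      by (simp add: integral_diff gi)
    have "\<bar>G v t - G w t\<bar> = exp (- K * t) * \<bar>integral {T1..t} (g v) - integral {T1..t} (g w)\<bar>"
      by (simp add: G_def abs_mult flip: right_diff_distrib)
    also have "\<dots> \<le> exp (- K * t) * (D / 2 * exp (K * t))" by (intro mult_left_mono I) auto
    also have "\<dots> = D / 2" by (simp add: exp_minus)
    finally show "dist (\<Phi> v t0) (\<Phi> w t0) \<le> (1/2) * dist v w"
      by (simp add: \<Phi> dist_real_def t_def[symmetric] D_def)
  qed
  then have "\<exists>!w. \<Phi> w = w" by (intro banach_fix_type[of "1/2"]) auto
  then obtain w where w: "\<Phi> w = w" by blast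
  define \<theta> where "\<theta> t = exp (K * t) * w t" for t
  have gw: "g w = (\<lambda>s. f s (\<theta> s))" by (simp add: g_def \<theta>_def fun_eq_iff)
  have \<theta>: "\<theta> t = x0 + integral {T1..t} (\<lambda>s. f s (\<theta> s))" if "t \<in> {T1..T2}" for t
  proof -
    have "w t = G w t" using \<Phi>[of w t] w cl_id[OF that] by simp
    then show ?thesis by (simp add: \<theta>_def G_def gw exp_minus)
  qed
  have "(\<theta> has_real_derivative f t (\<theta> t)) (at t within {T1..T2})" if t: "t \<in> {T1..T2}" for t
  proof -
    have "continuous_on {T1..T2} (\<lambda>s. f s (\<theta> s))" using g_cont[of w] by (simp add: gw)
    from integral_has_real_derivative[OF this t]
    have "((\<lambda>t. x0 + integral {T1..t} (\<lambda>s. f s (\<theta> s))) has_real_derivative f t (\<theta> t)) (at t within {T1..T2})"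
      by (auto intro!: derivative_eq_intros)
    then show ?thesis by (rule has_field_derivative_transform_within[OF _ zero_less_one t]) (use \<theta> in auto)
  qed
  then show ?thesis using \<theta>[of T1] \<open>T1 \<le> T2\<close> by auto
qed

text \<open>
  A Gronwall argument: \<open>(d\<^sup>2 + \<delta>\<^sup>2) exp (- C t)\<close> decreases, where \<open>d\<close> is the difference of the
  two solutions.  The added \<open>\<delta>\<^sup>2\<close> absorbs the inhomogeneity, and squaring avoids
  differentiating an absolute value.
\<close>

lemma scalar_ivp_dependence:
  fixes f g :: "real \<Rightarrow> real \<Rightarrow> real"
  assumes "T1 \<le> T2"
    and \<theta>: "\<And>t. t \<in> {T1..T2} \<Longrightarrow> (\<theta> has_real_derivative f t (\<theta> t)) (at t within {T1..T2})"
    and \<phi>: "\<And>t. t \<in> {T1..T2} \<Longrightarrow> (\<phi> has_real_derivative g t (\<phi> t)) (at t within {T1..T2})"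
    and lip: "\<And>t x y. t \<in> {T1..T2} \<Longrightarrow> \<bar>f t x - f t y\<bar> \<le> L * \<bar>x - y\<bar>"
    and close: "\<And>t x. t \<in> {T1..T2} \<Longrightarrow> \<bar>f t x - g t x\<bar> \<le> \<delta>"
    and init: "\<theta> T1 = \<phi> T1"
  shows "\<bar>\<theta> T2 - \<phi> T2\<bar> \<le> exp ((2 * L + 1) * (T2 - T1)) * \<delta>"
proof -
  define C where "C = 2 * L + 1"
  have d0: "\<delta> \<ge> 0" using close[of T1] \<open>T1 \<le> T2\<close> by (smt (verit) atLeastAtMost_iff)
  have L0: "L \<ge> 0" using lip[of T1 1 0] \<open>T1 \<le> T2\<close> by simp
  define d where "d t = \<theta> t - \<phi> t" for t
  define d' where "d' t = f t (\<theta> t) - g t (\<phi> t)" for t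
  \<comment> \<open>The constant \<open>C = 2 L + 1\<close> bounds \<open>2 d d'\<close> by \<open>C d\<^sup>2 + \<delta>\<^sup>2\<close>.\<close>
  define F where "F t = ((d t)\<^sup>2 + \<delta>\<^sup>2) * exp (- C * t)" for t
  have dd: "(d has_real_derivative d' t) (at t within {T1..T2})" if "t \<in> {T1..T2}" for t
    unfolding d_def d'_def by (intro DERIV_diff \<theta> \<phi> that)
  have Fd: "(F has_real_derivative (2 * d t * d' t - C * ((d t)\<^sup>2 + \<delta>\<^sup>2)) * exp (- C * t)) (at t within {T1..T2})"
    if "t \<in> {T1..T2}" for t
    unfolding F_def by (rule derivative_eq_intros dd that refl)+ (simp add: algebra_simps)
  have "F T2 \<le> F T1"
  proof (rule DERIV_nonpos_imp_decreasing_open[OF \<open>T1 \<le> T2\<close>])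
    show "continuous_on {T1..T2} F" using Fd by (intro DERIV_continuous_on) blast
    fix t assume t: "T1 < t" "t < T2"
    have "\<bar>d' t\<bar> \<le> L * \<bar>d t\<bar> + \<delta>"
      using lip[of t "\<theta> t" "\<phi> t"] close[of t "\<phi> t"] t unfolding d_def d'_def by auto
    then have "\<bar>d t\<bar> * \<bar>d' t\<bar> \<le> \<bar>d t\<bar> * (L * \<bar>d t\<bar> + \<delta>)" by (intro mult_left_mono) auto
    moreover have "2 * (\<bar>d t\<bar> * \<delta>) \<le> \<bar>d t\<bar>\<^sup>2 + \<delta>\<^sup>2" using sum_squares_bound[of "\<bar>d t\<bar>" \<delta>] by (simp add: mult_ac)
    moreover have "d t * d' t \<le> \<bar>d t\<bar> * \<bar>d' t\<bar>" by (metis abs_ge_self abs_mult)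
    moreover have "\<bar>d t\<bar> * (L * \<bar>d t\<bar> + \<delta>) = L * (d t)\<^sup>2 + \<bar>d t\<bar> * \<delta>"
      by (simp add: algebra_simps power2_eq_square flip: abs_mult)
    ultimately have "2 * (d t * d' t) \<le> 2 * (L * (d t)\<^sup>2) + ((d t)\<^sup>2 + \<delta>\<^sup>2)" unfolding power2_abs by linarith
    moreover have "0 \<le> L * \<delta>\<^sup>2" using L0 by simp
    ultimately have "2 * d t * d' t - C * ((d t)\<^sup>2 + \<delta>\<^sup>2) \<le> 0" by (simp add: C_def algebra_simps)
    then show "\<exists>y. DERIV F t :> y \<and> y \<le> 0"
      using Fd[of t] t at_within_Icc_at[of T1 t T2] by (auto simp: mult_le_0_iff intro!: exI)
  qed
  then have *: "((d T2)\<^sup>2 + \<delta>\<^sup>2) * exp (- C * T2) \<le> \<delta>\<^sup>2 * exp (- C * T1)"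
    by (simp add: F_def d_def init)
  have 1: "exp (- C * T2) * exp (C * T2) = 1" by (simp flip: exp_add)
  have 2: "exp (- C * T1) * exp (C * T2) = exp (C * (T2 - T1))"
    by (simp add: algebra_simps flip: exp_add)
  from * have "((d T2)\<^sup>2 + \<delta>\<^sup>2) * exp (- C * T2) * exp (C * T2) \<le> \<delta>\<^sup>2 * exp (- C * T1) * exp (C * T2)"
    by (intro mult_right_mono) auto
  then have "(d T2)\<^sup>2 + \<delta>\<^sup>2 \<le> \<delta>\<^sup>2 * exp (C * (T2 - T1))"
    by (simp only: mult.assoc 1 2 mult_1_right)
  moreover have "\<delta>\<^sup>2 * exp (C * (T2 - T1)) \<le> (exp (C * (T2 - T1)) * \<delta>)\<^sup>2"
  proof -
    have "1 \<le> exp (C * (T2 - T1))" using L0 \<open>T1 \<le> T2\<close> by (simp add: C_def)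
    then have "exp (C * (T2 - T1)) * 1 \<le> exp (C * (T2 - T1)) * exp (C * (T2 - T1))" by (intro mult_left_mono) auto
    then have "\<delta>\<^sup>2 * exp (C * (T2 - T1)) \<le> \<delta>\<^sup>2 * (exp (C * (T2 - T1)) * exp (C * (T2 - T1)))"
      by (intro mult_left_mono) auto
    then show ?thesis by (simp add: power2_eq_square mult_ac)
  qed
  ultimately have "(d T2)\<^sup>2 \<le> (exp (C * (T2 - T1)) * \<delta>)\<^sup>2" by (smt (verit) zero_le_power2)
  then have "\<bar>d T2\<bar> \<le> \<bar>exp (C * (T2 - T1)) * \<delta>\<bar>" by (simp only: abs_le_square_iff)
  then have "\<bar>d T2\<bar> \<le> exp (C * (T2 - T1)) * \<delta>" using d0 by (simp add: abs_mult)
  then show ?thesis by (simp add: d_def C_def)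
qed

text \<open>
  A level at which the derivative is always positive can only be crossed upwards: before a time
  spent below it there would be a last time \<open>z\<close> at or above it, where the function equals \<open>c\<close>
  and yet increases.
\<close>

lemma stays_above_level:
  fixes f :: "real \<Rightarrow> real"
  assumes f: "\<And>t. t \<in> {a..b} \<Longrightarrow> (f has_real_derivative f' t) (at t within {a..b})"
    and pos: "\<And>t. t \<in> {a..b} \<Longrightarrow> f t = c \<Longrightarrow> f' t > 0"
    and "a \<le> s" "s < t" "t \<le> b" "c \<le> f s"
  shows "c < f t"
proof (rule ccontr)
  assume "\<not> c < f t"
  have cont: "continuous_on {a..b} f" using f by (intro DERIV_continuous_on) blast
  obtain t' where t': "s < t'" "t' \<le> t" "f t' < c"
  proof (cases "f t = c")
    case True
    then obtain d where d: "d > 0" "\<And>h. 0 < h \<Longrightarrow> t - h \<in> {a..b} \<Longrightarrow> h < d \<Longrightarrow> f (t - h) < f t"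
      using has_real_derivative_pos_inc_left[OF f[of t]] pos[of t] assms(3-5) by auto
    define h where "h = min (d/2) ((t - s)/2)"
    have "0 < h" "h < d" "h < t - s" using d(1) \<open>s < t\<close> by (auto simp: h_def min_def)
    then show ?thesis using d(2)[of h] assms(3-5) True by (intro that[of "t - h"]) auto
  next
    case False then show ?thesis using \<open>\<not> c < f t\<close> \<open>s < t\<close> by (intro that[of t]) auto
  qed
  define A where "A = {s..t'} \<inter> f -` {c..}"
  have sub: "continuous_on {s..t'} f" using assms t' by (intro continuous_on_subset[OF cont]) auto
  have "compact A" unfolding A_def
    using continuous_closed_preimage[OF sub] by (metis closed_atLeast closed_atLeastAtMost bounded_Int bounded_closed_interval compact_eq_bounded_closed)
  moreover have "s \<in> A" using assms t' by (auto simp: A_def)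
  ultimately obtain z where z: "z \<in> A" "\<And>x. x \<in> A \<Longrightarrow> x \<le> z" using compact_attains_sup[of A] by blast
  have zt: "s \<le> z" "z < t'" "c \<le> f z" using z(1) t' by (auto simp: A_def order_le_less)
  have "\<exists>x. z \<le> x \<and> x \<le> t' \<and> f x = c"
    using zt t' by (intro IVT2' continuous_on_subset[OF sub]) auto
  then obtain x where x: "z \<le> x" "x \<le> t'" "f x = c" by blast
  then have "x = z" using z(2)[of x] zt by (auto simp: A_def)
  then obtain d where d: "d > 0" "\<And>h. 0 < h \<Longrightarrow> z + h \<in> {a..b} \<Longrightarrow> h < d \<Longrightarrow> f z < f (z + h)"
    using has_real_derivative_pos_inc_right[OF f[of z]] pos[of z] x zt t' assms(3-5) by auto
  define h where "h = min (d/2) ((t' - z)/2)"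
  have h: "0 < h" "h < d" "h < t' - z" using d(1) zt by (auto simp: h_def min_def)
  then have "f z < f (z + h)" using d(2)[of h] zt t' assms(3-5) by auto
  then have "z + h \<in> A" using h zt by (auto simp: A_def)
  then show False using z(2)[of "z + h"] h by auto
qed

text \<open>
  The maximum principle with \<open>v\<close> in the role of \<open>p u'\<close>.  By Rolle \<open>v\<close> vanishes at some point
  inside the bump; as it increases, it is nonnegative afterwards, and \<open>u\<close> cannot come back to
  zero.
\<close>

lemma no_convex_bump:
  fixes u v :: "real \<Rightarrow> real"
  assumes "\<alpha> < \<beta>" and cu: "continuous_on {\<alpha>..\<beta>} u" and cv: "continuous_on {\<alpha>..\<beta>} v"
    and "u \<alpha> = 0" "u \<beta> = 0" and pos: "\<And>t. \<alpha> < t \<Longrightarrow> t < \<beta> \<Longrightarrow> u t > 0"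
    and p: "\<And>t. \<alpha> < t \<Longrightarrow> t < \<beta> \<Longrightarrow> p t > 0"
    and u: "\<And>t. \<alpha> < t \<Longrightarrow> t < \<beta> \<Longrightarrow> (u has_real_derivative v t / p t) (at t)"
    and v: "\<And>t. \<alpha> < t \<Longrightarrow> t < \<beta> \<Longrightarrow> (v has_real_derivative w t) (at t)"
    and w: "\<And>t. \<alpha> < t \<Longrightarrow> t < \<beta> \<Longrightarrow> w t \<ge> 0"
  shows False
proof -
  have ud: "(u has_derivative (*) (v t / p t)) (at t)" if "\<alpha> < t" "t < \<beta>" for t
    using u[OF that] by (simp add: has_field_derivative_def)
  obtain z where z: "\<alpha> < z" "z < \<beta>" "(*) (v z / p z) = (\<lambda>x. 0)"
    using Rolle_deriv[OF \<open>\<alpha> < \<beta>\<close> _ cu ud] \<open>u \<alpha> = 0\<close> \<open>u \<beta> = 0\<close> by auto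
  have "v z / p z = 0" using fun_cong[OF z(3), of 1] by simp
  then have "v z = 0" using p[OF z(1,2)] by simp
  have vpos: "v t \<ge> 0" if "z \<le> t" "t \<le> \<beta>" for t
  proof -
    have "v z \<le> v t"
    proof (rule DERIV_nonneg_imp_increasing_open[where f = v])
      show "continuous_on {z..t} v" using z that by (intro continuous_on_subset[OF cv]) auto
      fix x assume "z < x" "x < t"
      then have "\<alpha> < x" "x < \<beta>" using z that by auto
      then show "\<exists>y. DERIV v x :> y \<and> y \<ge> 0" using v w by blast
    qed (rule \<open>z \<le> t\<close>)
    then show ?thesis using \<open>v z = 0\<close> by simp
  qed
  have "u z \<le> u \<beta>"
  proof (rule DERIV_nonneg_imp_increasing_open[where f = u])
    show "continuous_on {z..\<beta>} u" using z by (intro continuous_on_subset[OF cu]) auto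
    fix t assume t: "z < t" "t < \<beta>"
    then have "v t / p t \<ge> 0" using vpos[of t] p[of t] z by auto
    then show "\<exists>y. DERIV u t :> y \<and> y \<ge> 0" using u[of t] t z by auto
  qed (use z in auto)
  then show False using pos[of z] z \<open>u \<beta> = 0\<close> by simp
qed

section \<open>Zeros of solutions and signs of the weight\<close>

lemma continuous_on_Icc_abs_bounded:
  fixes f :: "real \<Rightarrow> real"
  assumes "continuous_on {a..b} f"
  obtains B where "B \<ge> 0" "\<And>t. t \<in> {a..b} \<Longrightarrow> \<bar>f t\<bar> \<le> B"
proof -
  have "bounded (f ` {a..b})"
    by (intro compact_imp_bounded compact_continuous_image assms compact_Icc)
  then obtain B where "B > 0" "\<forall>x\<in>f ` {a..b}. norm x \<le> B" using bounded_pos by blast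
  then show ?thesis by (intro that[of B]) auto
qed

locale sturm_problem =
  fixes T1 T2 :: real and p q m :: "real \<Rightarrow> real"
  assumes T1_less_T2: "T1 < T2"
    and p_cont: "continuous_on {T1..T2} p" and q_cont: "continuous_on {T1..T2} q"
    and m_cont: "continuous_on {T1..T2} m"
    and p_pos: "t \<in> {T1..T2} \<Longrightarrow> p t > 0" and q_nonneg: "t \<in> {T1..T2} \<Longrightarrow> q t \<ge> 0"
begin

lemma inverse_p_cont: "continuous_on {T1..T2} (\<lambda>t. 1 / p t)"
  using p_pos by (intro continuous_intros p_cont) force

lemma deriv_on_eq:
  assumes "(f has_real_derivative D) (at t within {T1..T2})" "t \<in> {T1..T2}"
  shows "deriv_on {T1..T2} f t = D"
  unfolding deriv_on_def
  using assms T1_less_T2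
  by (intro vector_derivative_within_closed_interval) (simp_all add: has_real_derivative_iff_has_vector_derivative)

lemma solution_P_intro:
  assumes u: "\<And>t. t \<in> {T1..T2} \<Longrightarrow> (u has_real_derivative v t / p t) (at t within {T1..T2})"
    and v: "\<And>t. t \<in> {T1..T2} \<Longrightarrow>
      (v has_real_derivative q t * u t - m t * (a * ppart u t - b * npart u t)) (at t within {T1..T2})"
    and "u T1 = 0" "u T2 = 0"
  shows "solution_P T1 T2 p q m a b u"
proof -
  have uc: "continuous_on {T1..T2} u" using u by (intro DERIV_continuous_on) blast
  have vc: "continuous_on {T1..T2} v" using v by (intro DERIV_continuous_on) blast
  have du: "deriv_on {T1..T2} u t = v t / p t" if "t \<in> {T1..T2}" for t
    using deriv_on_eq u that by blast
  have pd: "((\<lambda>t. p t * deriv_on {T1..T2} u t) has_real_derivative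
      q t * u t - m t * (a * ppart u t - b * npart u t)) (at t within {T1..T2})" if t: "t \<in> {T1..T2}" for t
  proof (rule has_field_derivative_transform_within[OF v[OF t] zero_less_one t])
    fix s assume "s \<in> {T1..T2}"
    then show "v s = p s * deriv_on {T1..T2} u s" using du[of s] p_pos[of s] by auto
  qed
  show ?thesis
    unfolding solution_P_def
  proof (intro conjI ballI)
    have "continuous_on {T1..T2} (\<lambda>t. v t / p t)"
      using p_pos by (intro continuous_intros vc p_cont) force
    then show "C1_on {T1..T2} u" unfolding C1_on_def
      using u by (intro exI[of _ "\<lambda>t. v t / p t"]) simp
    have "continuous_on {T1..T2} (\<lambda>t. q t * u t - m t * (a * ppart u t - b * npart u t))"
      unfolding ppart_def npart_def by (intro continuous_intros uc q_cont m_cont)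
    then show "C1_on {T1..T2} (\<lambda>t. p t * deriv_on {T1..T2} u t)" unfolding C1_on_def using pd
      by (intro exI[of _ "\<lambda>t. q t * u t - m t * (a * ppart u t - b * npart u t)"]) simp
    fix t assume "t \<in> {T1<..<T2}"
    then have "t \<in> {T1..T2}" by auto
    then show "Lop T1 T2 p q u t = m t * (a * ppart u t - b * npart u t)"
      unfolding Lop_def by (simp add: deriv_on_eq[OF pd])
  qed fact+
qed

text \<open>
  The equation as a first-order system for \<open>u\<close> and the flux \<open>v = p u'\<close>.  The second equation
  is obtained in the open interval, where the problem imposes it, and \<open>v\<close> is continuous up to
  the end points.
\<close>

lemma solution_P_elim:
  assumes "solution_P T1 T2 p q m a b u"
  obtains v where "\<And>t. t \<in> {T1..T2} \<Longrightarrow> (u has_real_derivative v t / p t) (at t within {T1..T2})"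
    and "continuous_on {T1..T2} v"
    and "\<And>t. T1 < t \<Longrightarrow> t < T2 \<Longrightarrow>
      (v has_real_derivative q t * u t - m t * (a * ppart u t - b * npart u t)) (at t)"
    and "v T1 = p T1 * deriv_on {T1..T2} u T1"
proof -
  define v where "v t = p t * deriv_on {T1..T2} u t" for t
  have v: "(\<lambda>t. p t * deriv_on {T1..T2} u t) = v" by (simp add: v_def fun_eq_iff)
  obtain u' where u': "\<And>t. t \<in> {T1..T2} \<Longrightarrow> (u has_real_derivative u' t) (at t within {T1..T2})"
    using assms unfolding solution_P_def C1_on_def by blast
  have "C1_on {T1..T2} v" using assms unfolding solution_P_def v by blast
  then obtain v' where v': "\<And>t. t \<in> {T1..T2} \<Longrightarrow> (v has_real_derivative v' t) (at t within {T1..T2})"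
    unfolding C1_on_def by blast
  have 4: "v T1 = p T1 * deriv_on {T1..T2} u T1" by (simp add: v_def)
  have 1: "(u has_real_derivative v t / p t) (at t within {T1..T2})" if "t \<in> {T1..T2}" for t
    using u'[OF that] deriv_on_eq[OF u'[OF that] that] p_pos[OF that] by (simp add: v_def)
  have 2: "continuous_on {T1..T2} v" using v' by (intro DERIV_continuous_on) blast
  have 3: "(v has_real_derivative q t * u t - m t * (a * ppart u t - b * npart u t)) (at t)"
    if t: "T1 < t" "t < T2" for t
  proof -
    have t': "t \<in> {T1..T2}" using t by auto
    have "- v' t + q t * u t = m t * (a * ppart u t - b * npart u t)"
      using assms t unfolding solution_P_def Lop_def v deriv_on_eq[OF v'[OF t'] t', symmetric]
      by (meson greaterThanLessThan_iff)
    then have "v' t = q t * u t - m t * (a * ppart u t - b * npart u t)" by linarith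
    then show ?thesis using v'[OF t'] at_within_Icc_at[OF t] by simp
  qed
  show ?thesis by (rule that[of v]) (fact 1 2 3 4)+
qed

text \<open>
  The system for \<open>(u, v)\<close> has linear growth, so \<open>(u\<^sup>2 + v\<^sup>2) exp (K t)\<close> increases for
  large \<open>K\<close>.  It is positive at \<open>T1\<close> and hence at every later point.
\<close>

lemma solution_zero_simple:
  assumes u: "\<And>t. t \<in> {T1..T2} \<Longrightarrow> (u has_real_derivative v t / p t) (at t within {T1..T2})"
    and vc: "continuous_on {T1..T2} v"
    and v: "\<And>t. T1 < t \<Longrightarrow> t < T2 \<Longrightarrow>
      (v has_real_derivative q t * u t - m t * (a * ppart u t - b * npart u t)) (at t)"
    and "v T1 \<noteq> 0" and z: "T1 < z" "z < T2" "u z = 0"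
  shows "v z \<noteq> 0"
proof
  assume "v z = 0"
  obtain P where P: "P \<ge> 0" "\<And>t. t \<in> {T1..T2} \<Longrightarrow> \<bar>1 / p t\<bar> \<le> P"
    using continuous_on_Icc_abs_bounded[OF inverse_p_cont] by blast
  obtain Q where Q: "Q \<ge> 0" "\<And>t. t \<in> {T1..T2} \<Longrightarrow> \<bar>q t\<bar> \<le> Q"
    using continuous_on_Icc_abs_bounded[OF q_cont] by blast
  obtain M where M: "M \<ge> 0" "\<And>t. t \<in> {T1..T2} \<Longrightarrow> \<bar>m t\<bar> \<le> M"
    using continuous_on_Icc_abs_bounded[OF m_cont] by blast
  define K where "K = P + Q + M * (\<bar>a\<bar> + \<bar>b\<bar>)"
  have uc: "continuous_on {T1..T2} u" using u by (intro DERIV_continuous_on) blast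
  define F where "F t = ((u t)\<^sup>2 + (v t)\<^sup>2) * exp (K * t)" for t
  have "F T1 \<le> F z"
  proof (rule DERIV_nonneg_imp_increasing_open[where f = F])
    show "continuous_on {T1..z} F" unfolding F_def
      by (intro continuous_intros continuous_on_subset[OF uc] continuous_on_subset[OF vc]) (use z in auto)
    fix t assume t: "T1 < t" "t < z"
    then have t': "t \<in> {T1..T2}" "T1 < t" "t < T2" using z by auto
    define w where "w = q t * u t - m t * (a * ppart u t - b * npart u t)"
    have "\<bar>a * ppart u t - b * npart u t\<bar> \<le> (\<bar>a\<bar> + \<bar>b\<bar>) * \<bar>u t\<bar>"
      by (cases "u t \<ge> 0") (auto simp: ppart_def npart_def max_def abs_mult distrib_right mult_nonneg_nonpos)
    then have "\<bar>m t\<bar> * \<bar>a * ppart u t - b * npart u t\<bar> \<le> M * ((\<bar>a\<bar> + \<bar>b\<bar>) * \<bar>u t\<bar>)"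
      using M t' by (intro mult_mono) auto
    moreover have "\<bar>q t\<bar> * \<bar>u t\<bar> \<le> Q * \<bar>u t\<bar>" using Q t' by (intro mult_right_mono) auto
    moreover have "\<bar>w\<bar> \<le> \<bar>q t\<bar> * \<bar>u t\<bar> + \<bar>m t\<bar> * \<bar>a * ppart u t - b * npart u t\<bar>"
      unfolding w_def by (metis abs_mult abs_triangle_ineq4)
    ultimately have w: "\<bar>w\<bar> \<le> (Q + M * (\<bar>a\<bar> + \<bar>b\<bar>)) * \<bar>u t\<bar>" by (simp add: algebra_simps)
    have up: "\<bar>v t / p t\<bar> \<le> P * \<bar>v t\<bar>"
      using mult_right_mono[OF P(2)[OF t'(1)], of "\<bar>v t\<bar>"] by (simp add: abs_divide)
    have "\<bar>u t * (v t / p t)\<bar> \<le> \<bar>u t\<bar> * (P * \<bar>v t\<bar>)"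
      unfolding abs_mult using up by (intro mult_left_mono) auto
    moreover have "\<bar>v t * w\<bar> \<le> \<bar>v t\<bar> * ((Q + M * (\<bar>a\<bar> + \<bar>b\<bar>)) * \<bar>u t\<bar>)"
      unfolding abs_mult using w by (intro mult_left_mono) auto
    ultimately have "\<bar>u t * (v t / p t)\<bar> + \<bar>v t * w\<bar> \<le> K * (\<bar>u t\<bar> * \<bar>v t\<bar>)"
      unfolding K_def by (simp add: algebra_simps)
    moreover have "K * (2 * (\<bar>u t\<bar> * \<bar>v t\<bar>)) \<le> K * ((u t)\<^sup>2 + (v t)\<^sup>2)"
      using sum_squares_bound[of "\<bar>u t\<bar>" "\<bar>v t\<bar>"] P Q M
      by (intro mult_left_mono) (auto simp: K_def)
    ultimately have nn: "0 \<le> 2 * u t * (v t / p t) + 2 * v t * w + K * ((u t)\<^sup>2 + (v t)\<^sup>2)" by linarith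
    have "(u has_real_derivative v t / p t) (at t)" using u[OF t'(1)] at_within_Icc_at[OF t'(2,3)] by simp
    moreover have "(v has_real_derivative w) (at t)" using v[OF t'(2,3)] by (simp add: w_def)
    ultimately have "(F has_real_derivative
        (2 * u t * (v t / p t) + 2 * v t * w + K * ((u t)\<^sup>2 + (v t)\<^sup>2)) * exp (K * t)) (at t)"
      unfolding F_def by (auto intro!: derivative_eq_intros simp: algebra_simps)
    then show "\<exists>y. DERIV F t :> y \<and> y \<ge> 0" using nn by (meson exp_ge_zero mult_nonneg_nonneg)
  qed (use z in auto)
  then have "((u T1)\<^sup>2 + (v T1)\<^sup>2) * exp (K * T1) \<le> 0" using z \<open>v z = 0\<close> by (simp add: F_def)
  moreover have "(u T1)\<^sup>2 + (v T1)\<^sup>2 > 0" using \<open>v T1 \<noteq> 0\<close> by (simp add: sum_power2_gt_zero_iff)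
  ultimately show False by (simp add: mult_le_0_iff)
qed

text \<open>
  A bump of sign \<open>\<sigma>\<close> solves an equation with coefficient \<open>a\<close> or \<open>b\<close> alone; if that coefficient
  is zero or the weight has the wrong sign throughout the bump, the flux of \<open>\<sigma> u\<close> increases,
  contradicting \<open>no_convex_bump\<close>.  The case of zero coefficients is the one that shows the final
  angle to be less than \<open>\<pi>\<close> for the parameter 0.
\<close>

lemma bump_weight_sign:
  assumes u: "\<And>t. t \<in> {T1..T2} \<Longrightarrow> (u has_real_derivative v t / p t) (at t within {T1..T2})"
    and vc: "continuous_on {T1..T2} v"
    and v: "\<And>t. T1 < t \<Longrightarrow> t < T2 \<Longrightarrow>
      (v has_real_derivative q t * u t - m t * (a * ppart u t - b * npart u t)) (at t)"
    and ab: "a \<ge> 0" "b \<le> 0"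
    and \<alpha>: "T1 \<le> \<alpha>" "\<alpha> < \<beta>" "\<beta> \<le> T2" and \<sigma>: "\<sigma> \<in> {1,-1}"
    and zero: "u \<alpha> = 0" "u \<beta> = 0" and pos: "\<And>t. \<alpha> < t \<Longrightarrow> t < \<beta> \<Longrightarrow> \<sigma> * u t > 0"
  shows "(if \<sigma> = 1 then a else b) \<noteq> 0 \<and> (\<exists>x. \<alpha> < x \<and> x < \<beta> \<and> \<sigma> * m x > 0)"
proof (rule ccontr)
  assume neg: "\<not> ?thesis"
  have uc: "continuous_on {T1..T2} u" using u by (intro DERIV_continuous_on) blast
  show False
  proof (rule no_convex_bump[OF \<open>\<alpha> < \<beta>\<close>, where u = "\<lambda>t. \<sigma> * u t" and v = "\<lambda>t. \<sigma> * v t" and p = p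
      and w = "\<lambda>t. \<sigma> * (q t * u t - m t * (a * ppart u t - b * npart u t))"])
    fix t assume t: "\<alpha> < t" "t < \<beta>"
    then have t': "t \<in> {T1..T2}" "T1 < t" "t < T2" using \<alpha> by auto
    show "p t > 0" using p_pos t' by blast
    have "(u has_real_derivative v t / p t) (at t)" using u[OF t'(1)] at_within_Icc_at[OF t'(2,3)] by simp
    then show "((\<lambda>t. \<sigma> * u t) has_real_derivative \<sigma> * v t / p t) (at t)"
      by (auto intro!: derivative_eq_intros)
    show "((\<lambda>t. \<sigma> * v t) has_real_derivative \<sigma> * (q t * u t - m t * (a * ppart u t - b * npart u t))) (at t)"
      using v[OF t'(2,3)] by (auto intro!: derivative_eq_intros)
    have "0 \<le> q t * (\<sigma> * u t)" using q_nonneg[OF t'(1)] pos[OF t] by simp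
    moreover have "\<sigma> * (m t * (a * ppart u t - b * npart u t)) \<le> 0"
    proof (cases "\<sigma> = 1")
      case True
      then have "u t > 0" using pos[OF t] by simp
      moreover have "a = 0 \<or> m t \<le> 0" using neg True t by force
      then have "m t * a \<le> 0" using ab by (auto simp: mult_le_0_iff)
      ultimately have "(m t * a) * u t \<le> 0" by (simp add: mult_le_0_iff)
      then show ?thesis using True \<open>u t > 0\<close> by (simp add: ppart_def npart_def mult_ac)
    next
      case False
      then have s: "\<sigma> = -1" using \<sigma> by auto
      then have "u t < 0" using pos[OF t] by simp
      moreover have "b = 0 \<or> m t \<ge> 0" using neg s t by force
      then have "m t * b \<le> 0" using ab by (auto simp: mult_le_0_iff)
      ultimately have "(m t * b) * u t \<ge> 0" by (simp add: mult_nonpos_nonpos)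
      then show ?thesis using s \<open>u t < 0\<close> by (simp add: ppart_def npart_def mult_ac)
    qed
    ultimately show "0 \<le> \<sigma> * (q t * u t - m t * (a * ppart u t - b * npart u t))"
      by (simp add: right_diff_distrib mult.left_commute)
  next
    show "continuous_on {\<alpha>..\<beta>} (\<lambda>t. \<sigma> * u t)" "continuous_on {\<alpha>..\<beta>} (\<lambda>t. \<sigma> * v t)"
      using \<alpha> by (auto intro!: continuous_intros continuous_on_subset[OF uc] continuous_on_subset[OF vc])
  qed (use zero pos in auto)
qed

text \<open>
  Induction on the number of zeros to the right of the zero \<open>\<alpha>\<close>.  The bump that starts at
  \<open>\<alpha>\<close> has the sign of \<open>v \<alpha>\<close> and contributes the first point of the chain; at the next zero
  \<open>\<zeta>\<close> the flux has the opposite sign, as \<open>\<zeta>\<close> is simple.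
\<close>

lemma solution_imp_alternating:
  assumes u: "\<And>t. t \<in> {T1..T2} \<Longrightarrow> (u has_real_derivative v t / p t) (at t within {T1..T2})"
    and vc: "continuous_on {T1..T2} v"
    and v: "\<And>t. T1 < t \<Longrightarrow> t < T2 \<Longrightarrow>
      (v has_real_derivative q t * u t - m t * (a * ppart u t - b * npart u t)) (at t)"
    and simple: "\<And>z. T1 < z \<Longrightarrow> z < T2 \<Longrightarrow> u z = 0 \<Longrightarrow> v z \<noteq> 0"
    and ab: "a > 0" "b < 0" and "u T2 = 0"
    and "T1 \<le> \<alpha>" "\<alpha> < T2" "u \<alpha> = 0" "\<sigma> \<in> {1,-1}" "\<sigma> * v \<alpha> > 0"
    and "finite {t. \<alpha> < t \<and> t < T2 \<and> u t = 0}" "card {t. \<alpha> < t \<and> t < T2 \<and> u t = 0} = n"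
  shows "alternating m T2 (Suc n) \<sigma> \<alpha>"
proof -
  have uc: "continuous_on {T1..T2} u" using u by (intro DERIV_continuous_on) blast
  have bump: "\<exists>x. \<alpha> < x \<and> x < \<zeta> \<and> \<sigma> * m x > 0"
     and bump_pos: "\<And>t. \<alpha> < t \<Longrightarrow> t < \<zeta> \<Longrightarrow> \<sigma> * u t > 0"
    if \<alpha>: "T1 \<le> \<alpha>" "\<alpha> < \<zeta>" "\<zeta> \<le> T2" "u \<alpha> = 0" "\<sigma> \<in> {1,-1}" "\<sigma> * v \<alpha> > 0" "u \<zeta> = 0"
      and nz: "\<And>t. \<alpha> < t \<Longrightarrow> t < \<zeta> \<Longrightarrow> u t \<noteq> 0" for \<alpha> \<zeta> \<sigma>
  proof -
    have a: "\<alpha> \<in> {T1..T2}" using \<alpha> by auto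
    have "((\<lambda>t. \<sigma> * u t) has_real_derivative \<sigma> * (v \<alpha> / p \<alpha>)) (at \<alpha> within {T1..T2})"
      by (intro DERIV_cmult u a)
    moreover have "\<sigma> * (v \<alpha> / p \<alpha>) > 0"
      using \<alpha>(6) p_pos[OF a] by simp
    ultimately obtain d where d: "d > 0"
        "\<And>h. h > 0 \<Longrightarrow> \<alpha> + h \<in> {T1..T2} \<Longrightarrow> h < d \<Longrightarrow> \<sigma> * u \<alpha> < \<sigma> * u (\<alpha> + h)"
      using has_real_derivative_pos_inc_right by metis
    show pos: "\<sigma> * u t > 0" if t: "\<alpha> < t" "t < \<zeta>" for t
    proof (rule ccontr)
      assume "\<not> \<sigma> * u t > 0"
      then have neg: "\<sigma> * u t \<le> 0" by simp
      define h where "h = min (d/2) (t - \<alpha>)"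
      have h: "0 < h" "h < d" "h \<le> t - \<alpha>" using d(1) t by (auto simp: h_def min_def)
      then have "\<sigma> * u (\<alpha> + h) > 0" using d(2)[of h] t \<alpha> by auto
      then have "\<exists>x. \<alpha> + h \<le> x \<and> x \<le> t \<and> \<sigma> * u x = 0"
        using neg h t \<alpha>
        by (intro IVT2' continuous_intros continuous_on_subset[OF uc]) auto
      then show False using nz h t \<alpha>(5) by force
    qed
    show "\<exists>x. \<alpha> < x \<and> x < \<zeta> \<and> \<sigma> * m x > 0"
      using bump_weight_sign[OF u vc v _ _ \<alpha>(1-3,5,4,7) pos] ab by auto
  qed
  show ?thesis
    using assms(8-)
  proof (induction n arbitrary: \<alpha> \<sigma>)
    case 0
    then have "{t. \<alpha> < t \<and> t < T2 \<and> u t = 0} = {}" by simp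
    then show ?case using bump[of \<alpha> T2 \<sigma>] 0 \<open>u T2 = 0\<close> by auto
  next
    case (Suc n)
    define Z where "Z = {t. \<alpha> < t \<and> t < T2 \<and> u t = 0}"
    have fin: "finite Z" "card Z = Suc n" using Suc.prems by (auto simp: Z_def)
    define \<zeta> where "\<zeta> = Min Z"
    have "Z \<noteq> {}" using fin by auto
    then have "\<zeta> \<in> Z" and \<zeta>_le: "\<And>t. t \<in> Z \<Longrightarrow> \<zeta> \<le> t" using fin by (auto simp: \<zeta>_def)
    then have \<zeta>: "\<alpha> < \<zeta>" "\<zeta> < T2" "u \<zeta> = 0" by (auto simp: Z_def)
    have nz: "u t \<noteq> 0" if "\<alpha> < t" "t < \<zeta>" for t using \<zeta>_le[of t] that \<zeta> by (auto simp: Z_def)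
    obtain x where x: "\<alpha> < x" "x < \<zeta>" "\<sigma> * m x > 0"
      using bump[of \<alpha> \<zeta> \<sigma>] Suc.prems \<zeta> nz by force
    have pos: "\<sigma> * u t > 0" if "\<alpha> < t" "t < \<zeta>" for t
      using bump_pos[of \<alpha> \<zeta> \<sigma> t] Suc.prems \<zeta> nz that by force
    have zi: "\<zeta> \<in> {T1..T2}" using \<zeta> Suc.prems by auto
    have "\<sigma> * v \<zeta> \<le> 0"
    proof (rule ccontr)
      assume "\<not> \<sigma> * v \<zeta> \<le> 0"
      then have "\<sigma> * (v \<zeta> / p \<zeta>) > 0" using p_pos[OF zi] by simp
      then obtain d where d: "d > 0"
          "\<And>h. h > 0 \<Longrightarrow> \<zeta> - h \<in> {T1..T2} \<Longrightarrow> h < d \<Longrightarrow> \<sigma> * u (\<zeta> - h) < \<sigma> * u \<zeta>"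
        using has_real_derivative_pos_inc_left[OF DERIV_cmult[OF u[OF zi]]] by metis
      define h where "h = min (d/2) ((\<zeta> - \<alpha>)/2)"
      have h: "0 < h" "h < d" "h < \<zeta> - \<alpha>" using d(1) \<zeta> by (auto simp: h_def min_def)
      then show False using d(2)[of h] pos[of "\<zeta> - h"] \<zeta> zi Suc.prems by auto
    qed
    then have "- \<sigma> * v \<zeta> > 0" using simple[of \<zeta>] \<zeta> Suc.prems by (auto simp: order_le_less)
    moreover have "{t. \<zeta> < t \<and> t < T2 \<and> u t = 0} = Z - {\<zeta>}"
      using \<zeta>_le \<zeta> by (force simp: Z_def order_le_less)
    ultimately have "alternating m T2 (Suc n) (-\<sigma>) \<zeta>"
      using Suc.prems \<zeta> fin \<open>\<zeta> \<in> Z\<close> by (intro Suc.IH) auto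
    then have "alternating m T2 (Suc n) (-\<sigma>) x" by (rule alternating_left) (use x in simp)
    then show ?case unfolding alternating.simps(2)[of m T2 "Suc n"]
      using x \<zeta> by (intro exI[of _ x]) auto
  qed
qed

section \<open>The polar angle as a function of the parameter\<close>

text \<open>
  The angular velocity of \<open>(p u', u)\<close> in the plane for a solution of \<open>L u = \<kappa> m \<bar>u\<bar>\<close>, as
  a function of the time \<open>t\<close> and the polar angle \<open>x\<close>.  The factor \<open>sin x * \<bar>sin x\<bar>\<close>, in place of
  the \<open>(sin x)\<^sup>2\<close> of the linear equation, comes from the absolute value.
\<close>

definition angular :: "real \<Rightarrow> real \<Rightarrow> real \<Rightarrow> real" where
  "angular \<kappa> t x = (cos x)\<^sup>2 / p t - q t * (sin x)\<^sup>2 + \<kappa> * m t * (sin x * \<bar>sin x\<bar>)"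

definition angle :: "real \<Rightarrow> real \<Rightarrow> real" where
  "angle \<kappa> = (SOME \<theta>. \<theta> T1 = 0 \<and>
     (\<forall>t\<in>{T1..T2}. (\<theta> has_real_derivative angular \<kappa> t (\<theta> t)) (at t within {T1..T2})))"

lemma angular_cont: "continuous_on ({T1..T2} \<times> UNIV) (\<lambda>(t, x). angular \<kappa> t x)"
proof -
  have fst: "continuous_on ({T1..T2} \<times> UNIV) (\<lambda>z. f (fst z))"
    if "continuous_on {T1..T2} f" for f :: "real \<Rightarrow> real"
    using that by (rule continuous_on_compose2) (auto intro!: continuous_intros)
  show ?thesis unfolding angular_def case_prod_unfold
    by (intro continuous_intros fst p_cont q_cont m_cont) (use p_pos in force)
qed

lemma angular_lipschitz:
  "\<exists>C\<ge>0. \<forall>\<kappa> x y. \<forall>t\<in>{T1..T2}. \<bar>angular \<kappa> t x - angular \<kappa> t y\<bar> \<le> C * (1 + \<bar>\<kappa>\<bar>) * \<bar>x - y\<bar>"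
proof -
  obtain P where P: "P \<ge> 0" "\<And>t. t \<in> {T1..T2} \<Longrightarrow> \<bar>1 / p t\<bar> \<le> P"
    using continuous_on_Icc_abs_bounded[OF inverse_p_cont] by blast
  obtain Q where Q: "Q \<ge> 0" "\<And>t. t \<in> {T1..T2} \<Longrightarrow> \<bar>q t\<bar> \<le> Q"
    using continuous_on_Icc_abs_bounded[OF q_cont] by blast
  obtain M where M: "M \<ge> 0" "\<And>t. t \<in> {T1..T2} \<Longrightarrow> \<bar>m t\<bar> \<le> M"
    using continuous_on_Icc_abs_bounded[OF m_cont] by blast
  define C where "C = 2 * (P + Q + M)"
  have "\<bar>angular \<kappa> t x - angular \<kappa> t y\<bar> \<le> C * (1 + \<bar>\<kappa>\<bar>) * \<bar>x - y\<bar>" if t: "t \<in> {T1..T2}" for \<kappa> x y t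
  proof -
    define s where "s = sin x"
    define r where "r = sin y"
    have sr: "\<bar>s\<bar> \<le> 1" "\<bar>r\<bar> \<le> 1" by (auto simp: s_def r_def)
    have d: "\<bar>s - r\<bar> \<le> \<bar>x - y\<bar>" unfolding s_def r_def by (rule abs_sin_diff_le)
    have sq: "\<bar>s\<^sup>2 - r\<^sup>2\<bar> \<le> 2 * \<bar>x - y\<bar>"
    proof -
      have "\<bar>s\<^sup>2 - r\<^sup>2\<bar> = \<bar>s + r\<bar> * \<bar>s - r\<bar>"
        by (simp add: power2_eq_square square_diff_square_factored abs_mult)
      also have "\<dots> \<le> 2 * \<bar>x - y\<bar>" using sr d by (intro mult_mono) auto
      finally show ?thesis .
    qed
    have ab: "\<bar>s * \<bar>s\<bar> - r * \<bar>r\<bar>\<bar> \<le> 2 * \<bar>x - y\<bar>"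
    proof -
      have "s * \<bar>s\<bar> - r * \<bar>r\<bar> = s * (\<bar>s\<bar> - \<bar>r\<bar>) + (s - r) * \<bar>r\<bar>" by (simp add: algebra_simps)
      also have "\<bar>\<dots>\<bar> \<le> \<bar>s\<bar> * \<bar>\<bar>s\<bar> - \<bar>r\<bar>\<bar> + \<bar>s - r\<bar> * \<bar>r\<bar>"
        by (rule order_trans[OF abs_triangle_ineq]) (simp add: abs_mult)
      also have "\<dots> \<le> 1 * \<bar>x - y\<bar> + \<bar>x - y\<bar> * 1"
        using sr d abs_triangle_ineq3[of s r] by (intro add_mono mult_mono) auto
      finally show ?thesis by simp
    qed
    have "angular \<kappa> t x - angular \<kappa> t y = - (1 / p t) * (s\<^sup>2 - r\<^sup>2) - q t * (s\<^sup>2 - r\<^sup>2) + \<kappa> * (m t * (s * \<bar>s\<bar> - r * \<bar>r\<bar>))"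
      unfolding angular_def s_def r_def cos_squared_eq by (simp add: diff_divide_distrib algebra_simps)
    also have "\<bar>\<dots>\<bar> \<le> \<bar>1 / p t\<bar> * \<bar>s\<^sup>2 - r\<^sup>2\<bar> + \<bar>q t\<bar> * \<bar>s\<^sup>2 - r\<^sup>2\<bar> + \<bar>\<kappa>\<bar> * (\<bar>m t\<bar> * \<bar>s * \<bar>s\<bar> - r * \<bar>r\<bar>\<bar>)"
      by (rule order_trans[OF abs_triangle_ineq] add_mono order_trans[OF abs_triangle_ineq4])+ (auto simp: abs_mult)
    also have "\<dots> \<le> P * (2 * \<bar>x - y\<bar>) + Q * (2 * \<bar>x - y\<bar>) + \<bar>\<kappa>\<bar> * (M * (2 * \<bar>x - y\<bar>))"
      using P Q M t sq ab by (intro add_mono mult_mono mult_left_mono) auto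
    also have "\<dots> \<le> C * (1 + \<bar>\<kappa>\<bar>) * \<bar>x - y\<bar>"
    proof -
      have "0 \<le> (2 * M + 2 * \<bar>\<kappa>\<bar> * (P + Q)) * \<bar>x - y\<bar>" using P Q M by simp
      then show ?thesis unfolding C_def by (simp add: algebra_simps)
    qed
    finally show ?thesis .
  qed
  moreover have "C \<ge> 0" using P Q M by (simp add: C_def)
  ultimately show ?thesis by blast
qed

lemma angle_initial: "angle \<kappa> T1 = 0"
  and angle_deriv: "t \<in> {T1..T2} \<Longrightarrow>
    (angle \<kappa> has_real_derivative angular \<kappa> t (angle \<kappa> t)) (at t within {T1..T2})"
proof -
  obtain C where C: "\<And>\<kappa> t x y. t \<in> {T1..T2} \<Longrightarrow> \<bar>angular \<kappa> t x - angular \<kappa> t y\<bar> \<le> C * (1 + \<bar>\<kappa>\<bar>) * \<bar>x - y\<bar>"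
    using angular_lipschitz by blast
  have "\<exists>\<theta>. \<theta> T1 = 0 \<and>
     (\<forall>t\<in>{T1..T2}. (\<theta> has_real_derivative angular \<kappa> t (\<theta> t)) (at t within {T1..T2}))"
    by (rule scalar_ivp_solvable[OF angular_cont C]) (use T1_less_T2 in auto)
  from someI_ex[OF this] show "angle \<kappa> T1 = 0" "t \<in> {T1..T2} \<Longrightarrow>
    (angle \<kappa> has_real_derivative angular \<kappa> t (angle \<kappa> t)) (at t within {T1..T2})"
    unfolding angle_def[symmetric] by blast+
qed

lemma angle_cont: "continuous_on {T1..T2} (angle \<kappa>)"
  using angle_deriv by (intro DERIV_continuous_on) blast

lemma angle_end_cont: "continuous_on {0..\<Lambda>} (\<lambda>\<kappa>. angle \<kappa> T2)"
proof -
  obtain C where C: "C \<ge> 0" "\<And>\<kappa> t x y. t \<in> {T1..T2} \<Longrightarrow> \<bar>angular \<kappa> t x - angular \<kappa> t y\<bar> \<le> C * (1 + \<bar>\<kappa>\<bar>) * \<bar>x - y\<bar>"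
    using angular_lipschitz by blast
  obtain M where M: "M \<ge> 0" "\<And>t. t \<in> {T1..T2} \<Longrightarrow> \<bar>m t\<bar> \<le> M"
    using continuous_on_Icc_abs_bounded[OF m_cont] by blast
  define L where "L = C * (1 + \<bar>\<Lambda>\<bar>)"
  have "(exp ((2 * L + 1) * (T2 - T1)) * M)-lipschitz_on {0..\<Lambda>} (\<lambda>\<kappa>. angle \<kappa> T2)"
  proof (rule lipschitz_onI)
    fix \<kappa> \<mu> assume \<kappa>: "\<kappa> \<in> {0..\<Lambda>}" "\<mu> \<in> {0..\<Lambda>}"
    have "\<bar>angle \<kappa> T2 - angle \<mu> T2\<bar> \<le> exp ((2 * L + 1) * (T2 - T1)) * (M * \<bar>\<kappa> - \<mu>\<bar>)"
    proof (rule scalar_ivp_dependence[where ?T1.0 = T1 and ?T2.0 = T2 and \<theta> = "angle \<kappa>" and \<phi> = "angle \<mu>" and f = "angular \<kappa>" and g = "angular \<mu>"])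
      fix t x y assume t: "t \<in> {T1..T2}"
      have "C * (1 + \<bar>\<kappa>\<bar>) * \<bar>x - y\<bar> \<le> L * \<bar>x - y\<bar>"
        unfolding L_def using \<kappa> C(1) by (intro mult_mono) auto
      then show "\<bar>angular \<kappa> t x - angular \<kappa> t y\<bar> \<le> L * \<bar>x - y\<bar>" using C(2)[OF t, of \<kappa> x y] by linarith
      have "angular \<kappa> t x - angular \<mu> t x = (m t * (\<kappa> - \<mu>)) * (sin x * \<bar>sin x\<bar>)"
        by (simp add: angular_def algebra_simps)
      also have "\<bar>\<dots>\<bar> = (\<bar>m t\<bar> * \<bar>\<kappa> - \<mu>\<bar>) * (\<bar>sin x\<bar> * \<bar>sin x\<bar>)" by (simp add: abs_mult)
      also have "\<dots> \<le> (M * \<bar>\<kappa> - \<mu>\<bar>) * (1 * 1)"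
        using M t by (intro mult_mono) auto
      finally show "\<bar>angular \<kappa> t x - angular \<mu> t x\<bar> \<le> M * \<bar>\<kappa> - \<mu>\<bar>" by simp
    qed (use T1_less_T2 in \<open>auto simp: angle_initial intro: angle_deriv\<close>)
    then show "dist (angle \<kappa> T2) (angle \<mu> T2) \<le> exp ((2 * L + 1) * (T2 - T1)) * M * dist \<kappa> \<mu>"
      by (simp add: dist_real_def mult.assoc)
  qed (use M in auto)
  then show ?thesis by (rule lipschitz_on_continuous_on)
qed

text \<open>
  At a multiple of \<open>\<pi>\<close> the angular velocity equals \<open>1 / p\<close>.
\<close>

lemma angle_above:
  assumes "T1 \<le> s" "s < t" "t \<le> T2" "real i * pi \<le> angle \<kappa> s"
  shows "real i * pi < angle \<kappa> t"
proof (rule stays_above_level[OF angle_deriv _ assms])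
  fix t assume t: "t \<in> {T1..T2}" "angle \<kappa> t = real i * pi"
  have "sin (real i * pi) = 0" by simp
  moreover have "(cos (real i * pi))\<^sup>2 = 1" by (simp add: cos_squared_eq del: cos_npi)
  ultimately show "angular \<kappa> t (angle \<kappa> t) > 0" unfolding angular_def t(2) using p_pos[OF t(1)] by simp
qed

lemma angle_pos: "T1 < t \<Longrightarrow> t \<le> T2 \<Longrightarrow> 0 < angle \<kappa> t"
  using angle_above[of T1 t 0 \<kappa>] by (simp add: angle_initial)

text \<open>
  The radius that belongs to the angle: the system gives \<open>r' / r\<close> in terms of the angle alone.
\<close>

definition radius :: "real \<Rightarrow> real \<Rightarrow> real" where
  "radius \<kappa> t = exp (integral {T1..t} (\<lambda>s. sin (angle \<kappa> s) * cos (angle \<kappa> s) * (1 / p s + q s) -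
     \<kappa> * m s * (cos (angle \<kappa> s) * \<bar>sin (angle \<kappa> s)\<bar>)))"

text \<open>
  The solution with initial flux 1 of \<open>L u = \<kappa> m \<bar>u\<bar>\<close>, and its flux \<open>p u'\<close>, in polar
  form.
\<close>

definition osc :: "real \<Rightarrow> real \<Rightarrow> real" where
  "osc \<kappa> t = radius \<kappa> t * sin (angle \<kappa> t)"

definition osc_flux :: "real \<Rightarrow> real \<Rightarrow> real" where
  "osc_flux \<kappa> t = radius \<kappa> t * cos (angle \<kappa> t)"

lemma radius_pos: "radius \<kappa> t > 0"
  by (simp add: radius_def)

lemma
  assumes t: "t \<in> {T1..T2}"
  shows osc_deriv: "(osc \<kappa> has_real_derivative osc_flux \<kappa> t / p t) (at t within {T1..T2})"
    and osc_flux_deriv: "(osc_flux \<kappa> has_real_derivative q t * osc \<kappa> t - \<kappa> * m t * \<bar>osc \<kappa> t\<bar>) (at t within {T1..T2})"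
proof -
  define R where "R s = sin (angle \<kappa> s) * cos (angle \<kappa> s) * (1 / p s + q s) -
     \<kappa> * m s * (cos (angle \<kappa> s) * \<bar>sin (angle \<kappa> s)\<bar>)" for s
  have "continuous_on {T1..T2} R" unfolding R_def
    by (intro continuous_intros angle_cont inverse_p_cont q_cont m_cont)
  from integral_has_real_derivative[OF this t]
  have r: "(radius \<kappa> has_real_derivative radius \<kappa> t * R t) (at t within {T1..T2})"
    unfolding radius_def R_def[symmetric] by (auto intro!: derivative_eq_intros)
  note a = angle_deriv[OF t, of \<kappa>]
  define s where "s = sin (angle \<kappa> t)"
  define c where "c = cos (angle \<kappa> t)"
  have c2: "c\<^sup>2 = 1 - s\<^sup>2" by (simp add: s_def c_def cos_squared_eq)
  have ang: "angular \<kappa> t (angle \<kappa> t) = c\<^sup>2 / p t - q t * s\<^sup>2 + \<kappa> * m t * (s * \<bar>s\<bar>)"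
    by (simp add: angular_def s_def c_def)
  have Rt: "R t = s * c * (1 / p t + q t) - \<kappa> * m t * (c * \<bar>s\<bar>)" by (simp add: R_def s_def c_def)
  have "(osc \<kappa> has_real_derivative radius \<kappa> t * R t * s + radius \<kappa> t * (c * angular \<kappa> t (angle \<kappa> t))) (at t within {T1..T2})"
    unfolding osc_def s_def c_def by (rule derivative_eq_intros r a refl)+ simp
  moreover have "R t * s + c * angular \<kappa> t (angle \<kappa> t) = c / p t"
  proof -
    have "R t * s + c * angular \<kappa> t (angle \<kappa> t) = (c / p t) * (s\<^sup>2 + c\<^sup>2)"
      unfolding ang Rt by (simp add: algebra_simps power2_eq_square)
    then show ?thesis by (simp add: c2)
  qed
  ultimately show "(osc \<kappa> has_real_derivative osc_flux \<kappa> t / p t) (at t within {T1..T2})"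
    by (simp add: osc_flux_def c_def[symmetric] mult.assoc flip: distrib_left)
  have "(osc_flux \<kappa> has_real_derivative radius \<kappa> t * R t * c + radius \<kappa> t * (- s * angular \<kappa> t (angle \<kappa> t))) (at t within {T1..T2})"
    unfolding osc_flux_def s_def c_def by (rule derivative_eq_intros r a refl)+ simp
  moreover have "R t * c + - s * angular \<kappa> t (angle \<kappa> t) = q t * s - \<kappa> * m t * \<bar>s\<bar>"
  proof -
    have "R t * c + - s * angular \<kappa> t (angle \<kappa> t) = (q t * s - \<kappa> * m t * \<bar>s\<bar>) * (s\<^sup>2 + c\<^sup>2)"
      unfolding ang Rt by (simp add: algebra_simps power2_eq_square)
    then show ?thesis by (simp add: c2)
  qed
  moreover have "radius \<kappa> t * (q t * s - \<kappa> * m t * \<bar>s\<bar>) = q t * osc \<kappa> t - \<kappa> * m t * \<bar>osc \<kappa> t\<bar>"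
    using radius_pos[of \<kappa> t] by (simp add: osc_def s_def[symmetric] abs_mult algebra_simps)
  moreover have "radius \<kappa> t * R t * c + radius \<kappa> t * (- s * angular \<kappa> t (angle \<kappa> t)) =
      radius \<kappa> t * (R t * c + - s * angular \<kappa> t (angle \<kappa> t))" by (simp add: algebra_simps)
  ultimately show "(osc_flux \<kappa> has_real_derivative q t * osc \<kappa> t - \<kappa> * m t * \<bar>osc \<kappa> t\<bar>) (at t within {T1..T2})"
    by (simp only:)
qed

lemma osc_weight_form: "q t * osc \<kappa> t - \<kappa> * m t * \<bar>osc \<kappa> t\<bar> =
    q t * osc \<kappa> t - m t * (\<kappa> * ppart (osc \<kappa>) t - (- \<kappa>) * npart (osc \<kappa>) t)"
  by (auto simp: ppart_def npart_def max_def abs_if)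

text \<open>
  Reaching the angle \<open>\<pi>\<close> would mean a positive bump of a solution of \<open>L u = 0\<close>.
\<close>

lemma angle_zero_parameter: "angle 0 T2 < pi"
proof (rule ccontr)
  assume "\<not> angle 0 T2 < pi"
  then have "\<exists>z. T1 \<le> z \<and> z \<le> T2 \<and> angle 0 z = pi"
    using T1_less_T2 by (intro IVT' angle_cont) (auto simp: angle_initial)
  then obtain z where z: "T1 \<le> z" "z \<le> T2" "angle 0 z = pi" by blast
  have "T1 < z" using z angle_initial[of 0] by (auto simp: order_le_less)
  have "osc 0 t > 0" if t: "T1 < t" "t < z" for t
  proof -
    have "angle 0 t < pi" using angle_above[of t z 1 0] t z by force
    then have "sin (angle 0 t) > 0" using angle_pos[of t 0] t z by (intro sin_gt_zero) auto
    then show ?thesis using radius_pos by (simp add: osc_def)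
  qed
  moreover have "osc 0 T1 = 0" "osc 0 z = 0" using z by (auto simp: osc_def angle_initial)
  moreover have "continuous_on {T1..T2} (osc_flux 0)" using osc_flux_deriv by (intro DERIV_continuous_on) blast
  moreover have "(osc_flux 0 has_real_derivative q t * osc 0 t - m t * (0 * ppart (osc 0) t - 0 * npart (osc 0) t)) (at t)"
    if "T1 < t" "t < T2" for t
    using osc_flux_deriv[of t 0] that at_within_Icc_at[OF that] by simp
  ultimately show False
    using bump_weight_sign[of "osc 0" "osc_flux 0" 0 0 T1 z 1] osc_deriv \<open>T1 < z\<close> z by auto
qed

text \<open>
  While the angle lies between \<open>i \<pi>\<close> and \<open>(i + 1) \<pi>\<close>, the solution has the sign
  \<open>(-1)\<^sup>i\<close> of the weight, and the reduced angle \<open>\<phi> = \<theta> - i \<pi>\<close> satisfies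
  \<open>\<phi>' \<ge> A cos\<^sup>2 \<phi> + B sin\<^sup>2 \<phi>\<close> with \<open>A\<close> fixed and \<open>B\<close> as large as desired.  With
  \<open>k = sqrt (A / B)\<close> the derivative of \<open>arctan (k cot \<phi>)\<close> is then at most \<open>- A / k\<close>.
  Since the arctangent varies by less than \<open>\<pi>\<close>, this cannot last for a time
  \<open>\<pi> k / A\<close>.
\<close>

lemma angle_traverse:
  assumes cd: "T1 \<le> c" "c < d" "d \<le> T2" and "\<mu> > 0"
    and weight: "\<And>t. t \<in> {c..d} \<Longrightarrow> (-1)^i * m t \<ge> \<mu>"
  shows "\<exists>\<Lambda>. \<forall>\<kappa>\<ge>\<Lambda>. real i * pi \<le> angle \<kappa> c \<longrightarrow> real (Suc i) * pi \<le> angle \<kappa> d"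
proof -
  obtain P where P: "P \<ge> 0" "\<And>t. t \<in> {T1..T2} \<Longrightarrow> \<bar>p t\<bar> \<le> P"
    using continuous_on_Icc_abs_bounded[OF p_cont] by blast
  obtain Q where Q: "Q \<ge> 0" "\<And>t. t \<in> {T1..T2} \<Longrightarrow> \<bar>q t\<bar> \<le> Q"
    using continuous_on_Icc_abs_bounded[OF q_cont] by blast
  \<comment> \<open>The cotangent may be infinite at \<open>c\<close>, so only the second half \<open>[e, d]\<close> is used;
    \<open>k\<close> is chosen so that \<open>A / k * (d - e) = pi\<close>.\<close>
  define e where "e = (c + d) / 2"
  define A where "A = 1 / (P + 1)"
  define k where "k = A * (d - e) / pi"
  define B where "B = A / k\<^sup>2"
  have "A > 0" using P by (simp add: A_def)
  then have k: "k > 0" using cd by (simp add: k_def e_def field_simps)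
  have kB: "k * B = A / k" "B * k\<^sup>2 = A" using k by (auto simp: B_def power2_eq_square)
  have "B > 0" using k \<open>A > 0\<close> by (simp add: B_def)
  have Ak: "A / k * (d - e) = pi" using k \<open>A > 0\<close> cd by (simp add: k_def e_def field_simps)
  have "real (Suc i) * pi \<le> angle \<kappa> d" if \<kappa>: "\<kappa> \<ge> (Q + B) / \<mu>" and start: "real i * pi \<le> angle \<kappa> c" for \<kappa>
  proof (rule ccontr)
    assume notd: "\<not> real (Suc i) * pi \<le> angle \<kappa> d"
    have "\<kappa> \<ge> 0" using \<kappa> Q \<open>B > 0\<close> \<open>\<mu> > 0\<close> by (smt (verit) divide_nonneg_pos)
    define \<phi> where "\<phi> t = angle \<kappa> t - real i * pi" for t
    have range: "0 < \<phi> t \<and> \<phi> t < pi" if "c < t" "t \<le> d" for t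
    proof -
      have "angle \<kappa> t < real (Suc i) * pi"
      proof (rule ccontr)
        assume "\<not> angle \<kappa> t < real (Suc i) * pi"
        then have "real (Suc i) * pi \<le> angle \<kappa> t" by simp
        then show False using angle_above[of t d "Suc i" \<kappa>] notd cd that by (cases "t = d") auto
      qed
      then show ?thesis using angle_above[of c t i \<kappa>] start cd that by (simp add: \<phi>_def algebra_simps)
    qed
    have sc: "sin (angle \<kappa> t) = (-1)^i * sin (\<phi> t)" "cos (angle \<kappa> t) = (-1)^i * cos (\<phi> t)" for t
    proof -
      have "angle \<kappa> t = \<phi> t + real i * pi" by (simp add: \<phi>_def)
      then show "sin (angle \<kappa> t) = (-1)^i * sin (\<phi> t)" "cos (angle \<kappa> t) = (-1)^i * cos (\<phi> t)"
        by (simp_all only: sin_add cos_add sin_npi cos_npi) simp_all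
    qed
    have speed: "angular \<kappa> t (angle \<kappa> t) \<ge> A * (cos (\<phi> t))\<^sup>2 + B * (sin (\<phi> t))\<^sup>2"
      if t: "c < t" "t \<le> d" for t
    proof -
      have t': "t \<in> {T1..T2}" using t cd by auto
      have "sin (\<phi> t) > 0" using range[OF t] by (intro sin_gt_zero) auto
      then have sabs: "sin (angle \<kappa> t) * \<bar>sin (angle \<kappa> t)\<bar> = (-1)^i * (sin (\<phi> t))\<^sup>2"
        by (simp add: sc abs_mult power_abs power2_eq_square)
      have sq: "((-1)^i * x)\<^sup>2 = x\<^sup>2" for x :: real by (simp add: power_mult_distrib flip: power_mult)
      have "angular \<kappa> t (angle \<kappa> t) =
          (cos (\<phi> t))\<^sup>2 / p t + (\<kappa> * ((-1)^i * m t) - q t) * (sin (\<phi> t))\<^sup>2"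
        unfolding angular_def sabs unfolding sc sq by (simp add: algebra_simps)
      moreover have "(cos (\<phi> t))\<^sup>2 / p t \<ge> A * (cos (\<phi> t))\<^sup>2"
      proof -
        have "A \<le> 1 / p t" unfolding A_def using P(2)[OF t'] p_pos[OF t'] by (intro divide_left_mono) auto
        from mult_right_mono[OF this, of "(cos (\<phi> t))\<^sup>2"] show ?thesis by simp
      qed
      moreover have "(\<kappa> * ((-1)^i * m t) - q t) * (sin (\<phi> t))\<^sup>2 \<ge> B * (sin (\<phi> t))\<^sup>2"
      proof (intro mult_right_mono)
        have "Q + B \<le> \<kappa> * \<mu>" using \<kappa> \<open>\<mu> > 0\<close> by (simp add: pos_divide_le_eq)
        also have "\<dots> \<le> \<kappa> * ((-1)^i * m t)" using weight[of t] t \<open>\<kappa> \<ge> 0\<close> by (intro mult_left_mono) auto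
        finally show "B \<le> \<kappa> * ((-1)^i * m t) - q t" using Q(2)[OF t'] by auto
      qed simp
      ultimately show ?thesis by linarith
    qed
    define H where "H t = arctan (k * (cos (\<phi> t) / sin (\<phi> t))) + A / k * t" for t
    have "e < d" "c < e" using cd by (auto simp: e_def)
    have Hd: "(H has_real_derivative - k * angular \<kappa> t (angle \<kappa> t) / ((sin (\<phi> t))\<^sup>2 + k\<^sup>2 * (cos (\<phi> t))\<^sup>2) + A / k) (at t within {T1..T2})"
      if t: "c < t" "t \<le> d" for t
    proof -
      have t': "t \<in> {T1..T2}" using t cd by auto
      have s: "sin (\<phi> t) > 0" using range[OF t] by (intro sin_gt_zero) auto
      define S where "S = sin (\<phi> t)"
      define K where "K = cos (\<phi> t)"
      define D where "D = angular \<kappa> t (angle \<kappa> t)"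
      have "S > 0" using s by (simp add: S_def)
      have SK: "S\<^sup>2 + K\<^sup>2 = 1" by (simp add: S_def K_def)
      have \<phi>d: "(\<phi> has_real_derivative D) (at t within {T1..T2})"
        unfolding \<phi>_def D_def by (auto intro!: derivative_eq_intros angle_deriv[OF t'])
      have cot: "((\<lambda>t. cos (\<phi> t) / sin (\<phi> t)) has_real_derivative - D / S\<^sup>2) (at t within {T1..T2})"
      proof -
        have "((\<lambda>t. cos (\<phi> t) / sin (\<phi> t)) has_real_derivative ((- S * D) * S - K * (K * D)) / (S * S)) (at t within {T1..T2})"
          unfolding S_def K_def
          by (rule derivative_eq_intros \<phi>d refl | use s in simp)+
        moreover have "(- S * D) * S - K * (K * D) = - D"
        proof -
          have "(- S * D) * S - K * (K * D) = - D * (S\<^sup>2 + K\<^sup>2)" by (simp add: algebra_simps power2_eq_square)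
          then show ?thesis unfolding SK by simp
        qed
        ultimately show ?thesis by (simp only: power2_eq_square)
      qed
      have "(H has_real_derivative inverse (1 + (k * (K / S))\<^sup>2) * (k * (- D / S\<^sup>2)) + A / k) (at t within {T1..T2})"
        unfolding H_def S_def K_def
        by (rule derivative_eq_intros cot[unfolded S_def] refl | simp)+
      moreover have "inverse (1 + (k * (K / S))\<^sup>2) * (k * (- D / S\<^sup>2)) = - k * D / (S\<^sup>2 + k\<^sup>2 * K\<^sup>2)"
      proof -
        have "1 + (k * (K / S))\<^sup>2 = (S\<^sup>2 + k\<^sup>2 * K\<^sup>2) / S\<^sup>2"
          using \<open>S > 0\<close> by (simp add: field_simps)
        then show ?thesis using \<open>S > 0\<close> by simp
      qed
      ultimately show ?thesis unfolding S_def K_def D_def by simp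
    qed
    have "H e \<ge> H d"
    proof (rule DERIV_nonpos_imp_decreasing_open[where f = H])
      have "(H has_real_derivative - k * angular \<kappa> t (angle \<kappa> t) / ((sin (\<phi> t))\<^sup>2 + k\<^sup>2 * (cos (\<phi> t))\<^sup>2) + A / k) (at t within {e..d})"
        if "t \<in> {e..d}" for t
        using that \<open>c < e\<close> cd by (intro DERIV_subset[OF Hd]) auto
      then show "continuous_on {e..d} H" by (intro DERIV_continuous_on) blast
      fix t assume t: "e < t" "t < d"
      then have t': "c < t" "t \<le> d" "T1 < t" "t < T2" using \<open>c < e\<close> cd by auto
      define N where "N = (sin (\<phi> t))\<^sup>2 + k\<^sup>2 * (cos (\<phi> t))\<^sup>2"
      have "sin (\<phi> t) > 0" using range[OF t'(1,2)] by (intro sin_gt_zero) auto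
      then have "N > 0" by (auto simp: N_def intro!: add_pos_nonneg)
      have "B * N \<le> angular \<kappa> t (angle \<kappa> t)"
        using speed[OF t'(1,2)] kB(2) by (simp add: N_def algebra_simps flip: mult.assoc)
      then have "k * (B * N) \<le> k * angular \<kappa> t (angle \<kappa> t)" using k by simp
      then have "A / k \<le> k * angular \<kappa> t (angle \<kappa> t) / N"
        using \<open>N > 0\<close> kB(1) by (simp add: pos_le_divide_eq flip: mult.assoc)
      then have "- k * angular \<kappa> t (angle \<kappa> t) / N + A / k \<le> 0" by simp
      then show "\<exists>y. DERIV H t :> y \<and> y \<le> 0"
        using Hd[OF t'(1,2)] unfolding at_within_Icc_at[OF t'(3,4)] N_def[symmetric] by blast
    qed (use \<open>e < d\<close> in simp)
    then have "arctan (k * (cos (\<phi> d) / sin (\<phi> d))) + A / k * (d - e) \<le> arctan (k * (cos (\<phi> e) / sin (\<phi> e)))"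
      unfolding H_def right_diff_distrib by linarith
    then show False unfolding Ak
      using arctan_ubound[of "k * (cos (\<phi> e) / sin (\<phi> e))"] arctan_lbound[of "k * (cos (\<phi> d) / sin (\<phi> d))"] by linarith
  qed
  then show ?thesis by blast
qed

text \<open>
  Each point of the chain is the right end of a short interval on which \<open>m\<close> keeps its sign, and
  these intervals follow each other.  The angle never falls back below a multiple of \<open>\<pi>\<close>, so
  the half turns add up.
\<close>

lemma angle_large_parameter:
  assumes "alternating m T2 n ((-1)^i) \<alpha>" "T1 \<le> \<alpha>" "\<alpha> \<le> T2"
  shows "\<exists>\<Lambda>. \<forall>\<kappa>\<ge>\<Lambda>. real i * pi \<le> angle \<kappa> \<alpha> \<longrightarrow> real (i + n) * pi \<le> angle \<kappa> T2"
  using assms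
proof (induction n arbitrary: i \<alpha>)
  case 0
  have "real i * pi \<le> angle \<kappa> T2" if "real i * pi \<le> angle \<kappa> \<alpha>" for \<kappa>
    using angle_above[of \<alpha> T2 i \<kappa>] that 0 by (cases "\<alpha> = T2") auto
  then show ?case by simp
next
  case (Suc n)
  then obtain x where x: "\<alpha> < x" "x < T2" "(-1)^i * m x > 0" "alternating m T2 n ((-1)^Suc i) x"
    by auto
  define \<mu> where "\<mu> = (-1)^i * m x / 2"
  have "\<mu> > 0" using x by (simp add: \<mu>_def)
  have "continuous_on {T1..T2} (\<lambda>t. (-1)^i * m t)" by (intro continuous_intros m_cont)
  then have "isCont (\<lambda>t. (-1)^i * m t) x"
    using continuous_on_interior[of "{T1..T2}" _ x] x Suc.prems by simp
  then obtain \<delta> where \<delta>: "\<delta> > 0" "\<And>t. \<bar>t - x\<bar> < \<delta> \<Longrightarrow> \<bar>(-1)^i * m t - (-1)^i * m x\<bar> < \<mu>"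
    unfolding continuous_at_eps_delta dist_real_def using \<open>\<mu> > 0\<close> by blast
  define c where "c = max \<alpha> (x - \<delta>/2)"
  have c: "\<alpha> \<le> c" "c < x" "x - c < \<delta>" using x \<delta> by (auto simp: c_def max_def)
  have "(-1)^i * m t \<ge> \<mu>" if "t \<in> {c..x}" for t
  proof -
    have "\<bar>t - x\<bar> < \<delta>" using that c by auto
    moreover have "(-1)^i * m x = 2 * \<mu>" by (simp add: \<mu>_def)
    ultimately show ?thesis using \<delta>(2)[of t] by linarith
  qed
  then obtain \<Lambda>1 where \<Lambda>1: "\<forall>\<kappa>\<ge>\<Lambda>1. real i * pi \<le> angle \<kappa> c \<longrightarrow> real (Suc i) * pi \<le> angle \<kappa> x"
    using angle_traverse[of c x \<mu> i] c x Suc.prems \<open>\<mu> > 0\<close> by auto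
  obtain \<Lambda>2 where \<Lambda>2: "\<forall>\<kappa>\<ge>\<Lambda>2. real (Suc i) * pi \<le> angle \<kappa> x \<longrightarrow> real (Suc i + n) * pi \<le> angle \<kappa> T2"
    using Suc.IH[OF x(4)] x Suc.prems by auto
  have "real (i + Suc n) * pi \<le> angle \<kappa> T2" if "\<kappa> \<ge> max \<Lambda>1 \<Lambda>2" "real i * pi \<le> angle \<kappa> \<alpha>" for \<kappa>
  proof -
    have "real i * pi \<le> angle \<kappa> c"
      using angle_above[of \<alpha> c i \<kappa>] that c x Suc.prems by (cases "\<alpha> = c") auto
    then show ?thesis using \<Lambda>1 \<Lambda>2 that(1) by simp
  qed
  then show ?case by blast
qed

text \<open>
  The interior zeros are the times at which the angle is one of \<open>\<pi>, \<dots>, (k - 1) \<pi>\<close>, and each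
  of these levels is attained exactly once.
\<close>

lemma osc_exactly_zeros:
  assumes "angle \<kappa> T2 = real k * pi" "k \<ge> 1"
  shows "exactly_zeros T1 T2 (osc \<kappa>) (k - 1)"
proof -
  define Z where "Z = {t \<in> {T1<..<T2}. osc \<kappa> t = 0}"
  have inj: "inj_on (angle \<kappa>) Z"
  proof (rule linorder_inj_onI)
    fix s t assume st: "s < t" "s \<in> Z" "t \<in> Z"
    then have "sin (angle \<kappa> s) = 0" using radius_pos[of \<kappa> s] by (auto simp: Z_def osc_def)
    then obtain j :: int where j: "angle \<kappa> s = of_int j * pi" by (auto simp: sin_zero_iff_int2)
    have "0 < angle \<kappa> s" using angle_pos st by (auto simp: Z_def)
    then have "j > 0" using j by (simp add: zero_less_mult_iff)
    then have "real (nat j) * pi = angle \<kappa> s" using j by simp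
    then show "angle \<kappa> s \<noteq> angle \<kappa> t" using angle_above[of s t "nat j" \<kappa>] st by (auto simp: Z_def)
  qed auto
  have img: "angle \<kappa> ` Z = (\<lambda>i. real i * pi) ` {1..k - 1}"
  proof (intro equalityI subsetI)
    fix y assume "y \<in> angle \<kappa> ` Z"
    then obtain t where t: "T1 < t" "t < T2" "osc \<kappa> t = 0" "y = angle \<kappa> t" by (auto simp: Z_def)
    then have "sin (angle \<kappa> t) = 0" using radius_pos[of \<kappa> t] by (auto simp: osc_def)
    then obtain j :: int where j: "angle \<kappa> t = of_int j * pi" by (auto simp: sin_zero_iff_int2)
    have "0 < angle \<kappa> t" using angle_pos t by auto
    then have "j > 0" using j by (simp add: zero_less_mult_iff)
    moreover have "angle \<kappa> t < real k * pi" using angle_above[of t T2 k \<kappa>] t assms by force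
    then have "j < int k" unfolding j by (simp add: mult_less_cancel_right)
    ultimately show "y \<in> (\<lambda>i. real i * pi) ` {1..k - 1}"
      using t j by (intro image_eqI[of _ _ "nat j"]) auto
  next
    fix y assume "y \<in> (\<lambda>i. real i * pi) ` {1..k - 1}"
    then obtain i where "1 \<le> i" "i \<le> k - 1" "y = real i * pi" by auto
    then have i: "1 \<le> i" "i < k" "y = real i * pi" by auto
    have "\<exists>t. T1 \<le> t \<and> t \<le> T2 \<and> angle \<kappa> t = y"
      using i assms T1_less_T2 by (intro IVT' angle_cont) (auto simp: angle_initial)
    then obtain t where t: "T1 \<le> t" "t \<le> T2" "angle \<kappa> t = y" by blast
    have "t \<noteq> T1" "t \<noteq> T2" using t i assms by (auto simp: angle_initial)
    then have "t \<in> Z" using t i by (auto simp: Z_def osc_def)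
    then show "y \<in> angle \<kappa> ` Z" using t by blast
  qed
  have "finite Z" using inj img by (metis finite_imageD finite_imageI finite_atLeastAtMost)
  moreover have "card Z = k - 1"
  proof -
    have "card Z = card (angle \<kappa> ` Z)" using inj by (simp add: card_image)
    also have "\<dots> = card {1..k - 1}" unfolding img by (intro card_image inj_onI) simp
    finally show ?thesis by simp
  qed
  ultimately show ?thesis unfolding exactly_zeros_def Z_def by blast
qed

section \<open>Nonempty sets correspond to alternating chains\<close>

text \<open>
  The parameter pair produced from a chain is \<open>(\<kappa>, - \<kappa>)\<close>.  So whenever the set is nonempty,
  it meets the line \<open>a = - b\<close>.
\<close>

lemma C_gt_pm_nonempty_iff:
  assumes "k \<ge> 1"
  shows "C_gt_pm T1 T2 p q m k \<noteq> {} \<longleftrightarrow> alternating m T2 k 1 T1"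
proof
  assume "C_gt_pm T1 T2 p q m k \<noteq> {}"
  then obtain a b u where ab: "a > 0" "b < 0" and sol: "solution_P T1 T2 p q m a b u"
    and zeros: "exactly_zeros T1 T2 u (k - 1)" and slope: "deriv_on {T1..T2} u T1 > 0"
    by (auto simp: C_gt_pm_def C_gt_def)
  obtain v where v: "\<And>t. t \<in> {T1..T2} \<Longrightarrow> (u has_real_derivative v t / p t) (at t within {T1..T2})"
    "continuous_on {T1..T2} v"
    "\<And>t. T1 < t \<Longrightarrow> t < T2 \<Longrightarrow>
      (v has_real_derivative q t * u t - m t * (a * ppart u t - b * npart u t)) (at t)"
    "v T1 = p T1 * deriv_on {T1..T2} u T1"
    using solution_P_elim[OF sol] by blast
  have "v T1 > 0" using v(4) slope p_pos[of T1] T1_less_T2 by simp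
  have simple: "v z \<noteq> 0" if "T1 < z" "z < T2" "u z = 0" for z
    by (rule solution_zero_simple[OF v(1-3) _ that]) (use \<open>v T1 > 0\<close> in auto)
  have u0: "u T1 = 0" "u T2 = 0" using sol by (auto simp: solution_P_def)
  have "{t. T1 < t \<and> t < T2 \<and> u t = 0} = {t \<in> {T1<..<T2}. u t = 0}" by auto
  then have "finite {t. T1 < t \<and> t < T2 \<and> u t = 0}" "card {t. T1 < t \<and> t < T2 \<and> u t = 0} = k - 1"
    using zeros by (simp_all add: exactly_zeros_def)
  then have "alternating m T2 (Suc (k - 1)) 1 T1"
    by (intro solution_imp_alternating[OF v(1-3) simple ab u0(2) _ _ u0(1)])
      (use \<open>v T1 > 0\<close> T1_less_T2 in auto)
  then show "alternating m T2 k 1 T1" using assms by simp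
next
  assume alt: "alternating m T2 k 1 T1"
  obtain \<Lambda>0 where \<Lambda>0: "\<forall>\<kappa>\<ge>\<Lambda>0. 0 \<le> angle \<kappa> T1 \<longrightarrow> real k * pi \<le> angle \<kappa> T2"
    using angle_large_parameter[of k 0 T1] alt T1_less_T2 by auto
  define \<Lambda> where "\<Lambda> = max 0 \<Lambda>0"
  have "real k * pi \<le> angle \<Lambda> T2" using \<Lambda>0 by (simp add: \<Lambda>_def angle_initial)
  moreover have "1 * pi \<le> real k * pi" using assms by (intro mult_right_mono) auto
  then have k: "angle 0 T2 < real k * pi" using angle_zero_parameter by linarith
  ultimately have "\<exists>\<kappa>. 0 \<le> \<kappa> \<and> \<kappa> \<le> \<Lambda> \<and> angle \<kappa> T2 = real k * pi"
    by (intro IVT'[where f = "\<lambda>\<kappa>. angle \<kappa> T2"] angle_end_cont) (auto simp: \<Lambda>_def)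
  then obtain \<kappa> where \<kappa>: "0 \<le> \<kappa>" "angle \<kappa> T2 = real k * pi" by blast
  then have "\<kappa> > 0" using k by (cases "\<kappa> = 0") auto
  have "solution_P T1 T2 p q m \<kappa> (- \<kappa>) (osc \<kappa>)"
    using osc_deriv osc_flux_deriv[unfolded osc_weight_form] \<kappa>(2)
    by (intro solution_P_intro[where v = "osc_flux \<kappa>"]) (auto simp: osc_def angle_initial)
  moreover have "deriv_on {T1..T2} (osc \<kappa>) T1 > 0"
  proof -
    have "deriv_on {T1..T2} (osc \<kappa>) T1 = osc_flux \<kappa> T1 / p T1"
      using T1_less_T2 by (intro deriv_on_eq osc_deriv) auto
    then show ?thesis using radius_pos p_pos[of T1] T1_less_T2 by (simp add: osc_flux_def angle_initial)
  qed
  ultimately have "(\<kappa>, - \<kappa>) \<in> C_gt_pm T1 T2 p q m k"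
    using osc_exactly_zeros[OF \<kappa>(2) assms] \<open>\<kappa> > 0\<close> by (auto simp: C_gt_pm_def C_gt_def)
  then show "C_gt_pm T1 T2 p q m k \<noteq> {}" by blast
qed

text \<open>
  Equality on the interval is all that is known when this is applied to the fluxes of \<open>- u\<close> and
  \<open>u\<close>: outside the interval \<open>deriv_on\<close> is a derivative without meaning.
\<close>

lemma C1_on_uminus:
  assumes "C1_on {T1..T2} f" "\<And>t. t \<in> {T1..T2} \<Longrightarrow> g t = - f t"
  shows "C1_on {T1..T2} g"
    and "t \<in> {T1..T2} \<Longrightarrow> deriv_on {T1..T2} g t = - deriv_on {T1..T2} f t"
proof -
  obtain f' where f': "\<And>t. t \<in> {T1..T2} \<Longrightarrow> (f has_real_derivative f' t) (at t within {T1..T2})"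
    and c: "continuous_on {T1..T2} f'"
    using assms(1) unfolding C1_on_def by blast
  have g': "(g has_real_derivative - f' t) (at t within {T1..T2})" if "t \<in> {T1..T2}" for t
    by (rule has_field_derivative_transform_within[OF DERIV_minus[OF f'[OF that]] zero_less_one that])
      (use assms(2) in simp)
  show "C1_on {T1..T2} g" unfolding C1_on_def
    using g' continuous_on_minus[OF c] by (intro exI[of _ "\<lambda>t. - f' t"]) simp
  show "deriv_on {T1..T2} g t = - deriv_on {T1..T2} f t" if "t \<in> {T1..T2}"
    using deriv_on_eq[OF g'[OF that] that] deriv_on_eq[OF f'[OF that] that] by simp
qed

text \<open>
  Replacing \<open>u\<close> by \<open>- u\<close> exchanges \<open>u\<^sup>+\<close> and \<open>u\<^sup>-\<close>.  Changing the sign of \<open>m\<close> at the same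
  time keeps the quadrant \<open>a > 0 > b\<close>, so initial slopes of either sign reduce to positive ones.
\<close>

lemma solution_P_uminus:
  assumes sol: "solution_P T1 T2 p q m a b u"
  shows "solution_P T1 T2 p q (\<lambda>t. - m t) (- b) (- a) (\<lambda>t. - u t)"
    and "deriv_on {T1..T2} (\<lambda>t. - u t) T1 = - deriv_on {T1..T2} u T1"
proof -
  have u: "C1_on {T1..T2} u" using sol by (simp add: solution_P_def)
  note du = C1_on_uminus[OF u, of "\<lambda>t. - u t", simplified]
  define f where "f t = p t * deriv_on {T1..T2} u t" for t
  define g where "g t = p t * deriv_on {T1..T2} (\<lambda>t. - u t) t" for t
  have f: "C1_on {T1..T2} f" using sol unfolding solution_P_def f_def by blast
  have "g t = - f t" if "t \<in> {T1..T2}" for t using du(2)[of t] that by (simp add: f_def g_def)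
  note dg = C1_on_uminus[OF f this]
  have "Lop T1 T2 p q (\<lambda>t. - u t) t = - m t * (- b * ppart (\<lambda>t. - u t) t - - a * npart (\<lambda>t. - u t) t)"
    if t: "t \<in> {T1<..<T2}" for t
  proof -
    have "Lop T1 T2 p q u t = m t * (a * ppart u t - b * npart u t)"
      using sol t unfolding solution_P_def by blast
    moreover have "t \<in> {T1..T2}" using t by simp
    ultimately show ?thesis
      using dg(2)[of t] unfolding Lop_def f_def[symmetric] g_def[symmetric]
      by (simp add: ppart_def npart_def algebra_simps)
  qed
  then show "solution_P T1 T2 p q (\<lambda>t. - m t) (- b) (- a) (\<lambda>t. - u t)"
    using du(1) dg(1) sol unfolding solution_P_def g_def by simp
  show "deriv_on {T1..T2} (\<lambda>t. - u t) T1 = - deriv_on {T1..T2} u T1"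
    using du(2)[of T1] T1_less_T2 by simp
qed

lemma
  shows C_lt_pm_uminus: "(a, b) \<in> C_lt_pm T1 T2 p q m k \<Longrightarrow> (- b, - a) \<in> C_gt_pm T1 T2 p q (\<lambda>t. - m t) k"
    and C_gt_pm_uminus: "(a, b) \<in> C_gt_pm T1 T2 p q m k \<Longrightarrow> (- b, - a) \<in> C_lt_pm T1 T2 p q (\<lambda>t. - m t) k"
proof -
  have zeros: "exactly_zeros T1 T2 (\<lambda>t. - u t) n = exactly_zeros T1 T2 u n" for u n
    by (simp add: exactly_zeros_def)
  show "(a, b) \<in> C_lt_pm T1 T2 p q m k \<Longrightarrow> (- b, - a) \<in> C_gt_pm T1 T2 p q (\<lambda>t. - m t) k"
    unfolding C_lt_pm_def C_lt_def C_gt_pm_def C_gt_def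
    using solution_P_uminus[of a b] zeros by fastforce
  show "(a, b) \<in> C_gt_pm T1 T2 p q m k \<Longrightarrow> (- b, - a) \<in> C_lt_pm T1 T2 p q (\<lambda>t. - m t) k"
    unfolding C_lt_pm_def C_lt_def C_gt_pm_def C_gt_def
    using solution_P_uminus[of a b] zeros by fastforce
qed

lemma sturm_problem_uminus: "sturm_problem T1 T2 p q (\<lambda>t. - m t)"
  using T1_less_T2 p_cont q_cont m_cont p_pos q_nonneg
  by unfold_locales (auto intro: continuous_on_minus)

lemma C_lt_pm_nonempty_iff:
  assumes "k \<ge> 1"
  shows "C_lt_pm T1 T2 p q m k \<noteq> {} \<longleftrightarrow> alternating m T2 k (-1) T1"
proof -
  interpret neg: sturm_problem T1 T2 p q "\<lambda>t. - m t" by (rule sturm_problem_uminus)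
  have "C_lt_pm T1 T2 p q m k \<noteq> {} \<longleftrightarrow> C_gt_pm T1 T2 p q (\<lambda>t. - m t) k \<noteq> {}"
    using C_lt_pm_uminus neg.C_gt_pm_uminus
    unfolding ex_in_conv[symmetric] split_paired_Ex minus_minus by blast
  then show ?thesis using neg.C_gt_pm_nonempty_iff[OF assms] by (simp add: alternating_uminus)
qed

end

theorem theorem4p4:
  fixes T1 T2 :: real and p q m :: "real \<Rightarrow> real" and N :: enat
  assumes "T1 < T2"
    and "continuous_on {T1..T2} p" and "continuous_on {T1..T2} q" and "continuous_on {T1..T2} m"
    and "\<forall>t\<in>{T1..T2}. p t > 0" and "\<forall>t\<in>{T1..T2}. q t \<ge> 0"
    and "not_identically_zero_on {T1..T2} m"
    and "changes_sign T1 T2 m"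
    and "N = num_sign_changes T1 T2 m"
  shows "1 \<le> N \<and> num_nonempty_sets T1 T2 p q m = 2 * N - 1"
proof -
  interpret sturm_problem T1 T2 p q m
    using assms by unfold_locales auto
  have "k \<ge> 2 \<and> C_gt_pm T1 T2 p q m k \<noteq> {} \<longleftrightarrow> k \<ge> 2 \<and> alternating m T2 k 1 T1"
    "k \<ge> 2 \<and> C_lt_pm T1 T2 p q m k \<noteq> {} \<longleftrightarrow> k \<ge> 2 \<and> alternating m T2 k (-1) T1" for k
    using C_gt_pm_nonempty_iff[of k] C_lt_pm_nonempty_iff[of k] by (cases "k \<ge> 2", simp_all)+
  then show ?thesis
    unfolding num_nonempty_sets_def by (simp only:) (use count_alternating[OF assms(4,8,9)] in simp)
qed

end
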